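(* Let $S_1,S_2$ be two skew semistandard tableaux of the same shape $\lambda/\mu$. The following are equivalent: (a) $S_1$ and $S_2$ are shape equivalent; (b) $S_1$ and $S_2$ have the same shape changes by some standard tableau of shape $\mu$; (c) the associated circled arrays of $S_1$ and $S_2$ coincide.
   Context: A skew semistandard tableau of shape $\lambda/\mu$ fills the boxes of $\lambda/\mu$ with positive integers weakly increasing along rows and strictly increasing down columns; boxes of $\mu$ are empty boxes. A (forward) jeu de taquin slide into an inside corner $b$ (a box of the inner shape with no inner-shape box below or to its right): $b$ is a hole; repeatedly move into the hole the smaller of the entries of the filled boxes immediately below and immediately to the right (the one below if equal; the only one if just one exists), the hole moving to the vacated position, until there is no filled box below or to the right; the hole is then removed from the shape. Given a standard tableau $T$ of shape $\mu$ with entries $1,\dots,m$ ($m=|\mu|$), rectifying a skew tableau of shape $\lambda/\mu$ by $T$ means performing jeu de taquin slides into the boxes of $\mu$ in decreasing order of their entries in $T$ ($m$ first, then $m-1$, $\dots$, $1$). Two skew tableaux of shape $\lambda/\mu$ have the same shape changes by $T$ if the sequences of shapes of the skew tableaux produced during these rectifications coincide; they are shape equivalent if they have the same shape changes by every standard tableau of shape $\mu$. Associated circled array: for a skew tableau $S$, let $F_{i,j}$ be the number of boxes in rows $1,\dots,i$ with entry $\le j$, empty boxes counted as entry $0$, and $W_{i,j}=F_{i,j}+F_{i,j+1}-F_{i-1,j}-F_{i+1,j+1}$ ($i\ge1$, $j\ge0$). Let $w_j$ be the one-rowed array with $W_{i,j}$ copies of $i$ for each $i$. The associated circled array of $S$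 is $w_N\leftharpoonup\cdots\leftharpoonup w_0$ for $N$ sufficiently large, empty rows at the bottom disregarded. Here a circled array is a finite list of rows of weakly increasing positive integers (circled; empty rows allowed), a one-rowed array is a finite weakly increasing sequence of positive integers (boxed), and $C\leftharpoonup x$ is defined by: $x^{(1)}=x$; for $p=1,\dots,r$ (rows $C_1,\dots,C_r$ of $C$), list circled entries of $C_p$ and boxed entries of $x^{(p)}$ in the order circled $1$'s, boxed $1$'s, circled $2$'s, boxed $2$'s, $\dots$; treat circled cells as balls and boxed cells as empty; move balls one at a time from left to right, each to the nearest cell on its right that was originally empty and not yet occupied by a moved ball, discarding balls with no such cell; then cells that originally had a ball become boxed with number decreased by one, originally empty cells receiving a ball become circled with the same number, others unchanged, boxed $0$'s deleted; the circled numbers form new row $p$, the boxed numbers form $x^{(p+1)}$; finally $x^{(r+1)}$ is appended as a new last circled row. $x_1\leftharpoonup\cdots\leftharpoonup x_n$ means acting successively with $x_1,\dots,x_n$ on the array with no rows. *)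

theory Defs
  imports Main
begin

text \<open>Boxes are pairs (row, column), 0-indexed: row r of the paper is r+1.
  A (skew) filling is a partial map from boxes to entries; the filled boxes are its domain.\<close>

type_synonym box = "nat \<times> nat"
type_synonym filling = "box \<Rightarrow> nat option"

definition is_partition :: "nat list \<Rightarrow> bool" where
  "is_partition lam \<longleftrightarrow> sorted_wrt (\<ge>) lam \<and> (\<forall>x\<in>set lam. 0 < x)"

definition diagram :: "nat list \<Rightarrow> box set" where
  "diagram lam = {(r, c). r < length lam \<and> c < lam ! r}"

definition skew_ssyt :: "nat list \<Rightarrow> nat list \<Rightarrow> filling \<Rightarrow> bool" where
  "skew_ssyt lam mu S \<longleftrightarrow>
     dom S = diagram lam - diagram mu \<and>
     (\<forall>b v. S b = Some v \<longrightarrow> 0 < v) \<and>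
     (\<forall>r c c' v v'. c \<le> c' \<longrightarrow> S (r, c) = Some v \<longrightarrow> S (r, c') = Some v' \<longrightarrow> v \<le> v') \<and>
     (\<forall>r r' c v v'. r < r' \<longrightarrow> S (r, c) = Some v \<longrightarrow> S (r', c) = Some v' \<longrightarrow> v < v')"

definition standard_tableau :: "nat list \<Rightarrow> (box \<Rightarrow> nat) \<Rightarrow> bool" where
  "standard_tableau mu T \<longleftrightarrow>
     bij_betw T (diagram mu) {1..card (diagram mu)} \<and>
     (\<forall>r c c'. (r, c) \<in> diagram mu \<longrightarrow> (r, c') \<in> diagram mu \<longrightarrow> c < c' \<longrightarrow> T (r, c) < T (r, c')) \<and>
     (\<forall>r r' c. (r, c) \<in> diagram mu \<longrightarrow> (r', c) \<in> diagram mu \<longrightarrow> r < r' \<longrightarrow> T (r, c) < T (r', c))"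

text \<open>One run of the hole: the hole is at position h (not a filled box). The argument n is
  fuel; the hole visits distinct originally filled boxes, so fuel card (dom F) suffices.
  The box below (i,j) is (i+1,j), the box to the right is (i,j+1); on ties the one
  below moves.\<close>
fun jdt_move :: "nat \<Rightarrow> filling \<Rightarrow> box \<Rightarrow> filling" where
  "jdt_move 0 F h = F"
| "jdt_move (Suc n) F (i, j) =
     (case (F (Suc i, j), F (i, Suc j)) of
        (None, None) \<Rightarrow> F
      | (Some x, None) \<Rightarrow> jdt_move n (F((i, j) := Some x, (Suc i, j) := None)) (Suc i, j)
      | (None, Some y) \<Rightarrow> jdt_move n (F((i, j) := Some y, (i, Suc j) := None)) (i, Suc j)
      | (Some x, Some y) \<Rightarrow>
          (if x \<le> y then jdt_move n (F((i, j) := Some x, (Suc i, j) := None)) (Suc i, j)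
           else jdt_move n (F((i, j) := Some y, (i, Suc j) := None)) (i, Suc j)))"

definition jdt_slide :: "filling \<Rightarrow> box \<Rightarrow> filling" where
  "jdt_slide F b = jdt_move (card (dom F)) F b"

fun jdt_shapes :: "box set \<Rightarrow> filling \<Rightarrow> box list \<Rightarrow> (box set \<times> box set) list" where
  "jdt_shapes I F [] = [(I \<union> dom F, I)]"
| "jdt_shapes I F (b # bs) = (I \<union> dom F, I) # jdt_shapes (I - {b}) (jdt_slide F b) bs"

definition rect_order :: "nat list \<Rightarrow> (box \<Rightarrow> nat) \<Rightarrow> box list" where
  "rect_order mu T = map (the_inv_into (diagram mu) T) (rev [1..<Suc (card (diagram mu))])"

definition shape_changes :: "nat list \<Rightarrow> (box \<Rightarrow> nat) \<Rightarrow> filling \<Rightarrow> (box set \<times> box set) list" where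
  "shape_changes mu T S = jdt_shapes (diagram mu) S (rect_order mu T)"

definition same_shape_changes :: "nat list \<Rightarrow> (box \<Rightarrow> nat) \<Rightarrow> filling \<Rightarrow> filling \<Rightarrow> bool" where
  "same_shape_changes mu T S1 S2 \<longleftrightarrow> shape_changes mu T S1 = shape_changes mu T S2"

definition shape_equivalent :: "nat list \<Rightarrow> filling \<Rightarrow> filling \<Rightarrow> bool" where
  "shape_equivalent mu S1 S2 \<longleftrightarrow>
     (\<forall>T. standard_tableau mu T \<longrightarrow> same_shape_changes mu T S1 S2)"

text \<open>A circled array is a list of rows (nat lists, weakly increasing); a one-rowed array is a
  weakly increasing nat list. Cells of a merged row are (value, is_circled) = (value, is_ball).\<close>

definition next_free :: "(nat \<times> bool) list \<Rightarrow> nat set \<Rightarrow> nat \<Rightarrow> nat option" where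
  "next_free cs occ k =
     (if \<exists>e. k < e \<and> e < length cs \<and> \<not> snd (cs ! e) \<and> e \<notin> occ
      then Some (LEAST e. k < e \<and> e < length cs \<and> \<not> snd (cs ! e) \<and> e \<notin> occ)
      else None)"

definition receivers :: "(nat \<times> bool) list \<Rightarrow> nat set" where
  "receivers cs =
     fold (\<lambda>k occ. if snd (cs ! k)
                   then (case next_free cs occ k of None \<Rightarrow> occ | Some e \<Rightarrow> insert e occ)
                   else occ) [0..<length cs] {}"

definition merge_cells :: "nat list \<Rightarrow> nat list \<Rightarrow> (nat \<times> bool) list" where
  "merge_cells c x =
     sort_key (\<lambda>(v, b). 2 * v + (if b then 0 else 1))
              (map (\<lambda>v. (v, True)) c @ map (\<lambda>v. (v, False)) x)"

definition row_step :: "nat list \<Rightarrow> nat list \<Rightarrow> nat list \<times> nat list" where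
  "row_step c x =
     (let cs = merge_cells c x;
          R = receivers cs;
          new = map (\<lambda>k. if snd (cs ! k) then (fst (cs ! k) - 1, False)
                         else if k \<in> R then (fst (cs ! k), True)
                         else (fst (cs ! k), False)) [0..<length cs]
      in (sort (map fst (filter snd new)),
          sort (filter (\<lambda>v. v \<noteq> 0) (map fst (filter (\<lambda>p. \<not> snd p) new)))))"

fun act :: "nat list list \<Rightarrow> nat list \<Rightarrow> nat list list" where
  "act [] x = [x]"
| "act (c # cs) x = (let (c', x') = row_step c x in c' # act cs x')"

definition act_seq :: "nat list list \<Rightarrow> nat list list" where
  "act_seq xs = foldl act [] xs"

definition strip_empty_rows :: "nat list list \<Rightarrow> nat list list" where
  "strip_empty_rows C = rev (dropWhile (\<lambda>r. r = []) (rev C))"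

definition Fcount :: "box set \<Rightarrow> filling \<Rightarrow> nat \<Rightarrow> nat \<Rightarrow> int" where
  "Fcount I S i j =
     int (card {(r, c). (r, c) \<in> I \<union> dom S \<and> r < i \<and>
                        (case S (r, c) of None \<Rightarrow> 0 | Some v \<Rightarrow> v) \<le> j})"

text \<open>W_{i,j}, for i \<ge> 1 (paper row index i).\<close>
definition Wcoef :: "box set \<Rightarrow> filling \<Rightarrow> nat \<Rightarrow> nat \<Rightarrow> int" where
  "Wcoef I S i j = Fcount I S i j + Fcount I S i (Suc j) - Fcount I S (i - 1) j - Fcount I S (Suc i) (Suc j)"

text \<open>w_j: W_{i,j} copies of i for each i \<ge> 1. Rows i beyond the number of boxes
  (hence beyond the last row of a partition shape) have W_{i,j} = 0.\<close>
definition wrow :: "box set \<Rightarrow> filling \<Rightarrow> nat \<Rightarrow> nat list" where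
  "wrow I S j = concat (map (\<lambda>i. replicate (nat (Wcoef I S i j)) i) [1..<card (I \<union> dom S) + 2])"

definition circ_array_upto :: "box set \<Rightarrow> filling \<Rightarrow> nat \<Rightarrow> nat list list" where
  "circ_array_upto I S N = strip_empty_rows (act_seq (map (wrow I S) (rev [0..<Suc N])))"

definition assoc_circled_array :: "box set \<Rightarrow> filling \<Rightarrow> nat list list" where
  "assoc_circled_array I S = (THE C. \<exists>N0. \<forall>N\<ge>N0. circ_array_upto I S N = C)"

end

theory Submission
  imports Defs "HOL-Library.Multiset"
begin

text \<open>
  A skew tableau is encoded by the row lengths \<open>l j r\<close> of the shapes formed by the boxes with entry
  at most \<open>j\<close>, and then \<open>w\<^sub>j\<close> contains \<open>l j (i - 1) - l (j + 1) i\<close> copies of \<open>i\<close>.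
  In these terms a slide removes one box from each shape, from row \<open>r\<^sub>j\<close> (counted from 1) of the
  \<open>j\<close>-th one: if \<open>w\<^sub>j\<close> contains \<open>r\<^sub>j\<close>, one copy is decreased by one and
  \<open>r\<^bsub>j+1\<^esub> = r\<^sub>j\<close>; otherwise \<open>r\<^bsub>j+1\<^esub> = r\<^sub>j + 1\<close>. Let a circled array react to a number
  \<open>r\<close> as in reverse row insertion: a row containing \<open>r\<close> has one copy decreased by one and passes on
  \<open>r - 1\<close>, any other row passes on \<open>r\<close>. One step of \<open>\<leftharpoonup>\<close> commutes with these two rules, so the slide
  acts on the associated circled array by the second rule, starting from the row of the chosen
  corner, and the row that passes on 0 is the row of the outer box that disappears.
  Hence the circled array and the corner determine the shape change and the new circled array;
  conversely reverse insertion is undone by insertion, so the shape change and the new array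
  determine the old one. As the array of a straight shape is empty, induction along the
  rectification by any fixed standard tableau shows that equal shape changes are the same as equal
  circled arrays.
\<close>

section \<open>Slides and the local rule\<close>

text \<open>Rows are given by multiplicities: \<open>c i\<close> circled and \<open>b i\<close> boxed copies of \<open>i \<ge> 1\<close>.
  The carry is the number of balls that have not found a cell with value at most \<open>i\<close>.\<close>
primrec carry :: "(nat \<Rightarrow> nat) \<Rightarrow> (nat \<Rightarrow> nat) \<Rightarrow> nat \<Rightarrow> nat" where
  "carry c b 0 = 0"
| "carry c b (Suc i) = carry c b i + c (Suc i) - b (Suc i)"

text \<open>In the merged row the balls of value \<open>i\<close> stand before the boxed cells of
  value \<open>i\<close>, so they compete for these together with the balls carried over from
  smaller values.\<close>

definition rowc :: "(nat \<Rightarrow> nat) \<Rightarrow> (nat \<Rightarrow> nat) \<Rightarrow> nat \<Rightarrow> nat" where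
  "rowc c b i = (case i of 0 \<Rightarrow> 0 | Suc k \<Rightarrow> min (carry c b k + c (Suc k)) (b (Suc k)))"

text \<open>A ball of value \<open>i + 1\<close> leaves a boxed \<open>i\<close>; boxed zeros are
  deleted, hence the value 0 at 0.\<close>

definition rowb :: "(nat \<Rightarrow> nat) \<Rightarrow> (nat \<Rightarrow> nat) \<Rightarrow> nat \<Rightarrow> nat" where
  "rowb c b i = (case i of 0 \<Rightarrow> 0 | Suc k \<Rightarrow> c (Suc (Suc k)) + b (Suc k) - rowc c b (Suc k))"

text \<open>Decreasing a copy of 1 deletes it. The number \<open>r = 0\<close> stands for one that
  is used up; it is left alone here and by \<open>circ_next\<close> and
  \<open>box_next\<close>.\<close>

definition lower :: "nat \<Rightarrow> (nat \<Rightarrow> nat) \<Rightarrow> nat \<Rightarrow> nat" where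
  "lower r f = (if 0 < r \<and> 0 < f r
     then (\<lambda>i. if i = 0 then 0 else if i = r then f i - 1 else if Suc i = r then f i + 1 else f i)
     else f)"

definition circ_next :: "nat \<Rightarrow> (nat \<Rightarrow> nat) \<Rightarrow> nat" where
  "circ_next r c = (if 0 < r \<and> 0 < c r then r - 1 else r)"

definition box_next :: "nat \<Rightarrow> (nat \<Rightarrow> nat) \<Rightarrow> nat" where
  "box_next r b = (if r = 0 \<or> 0 < b r then r else Suc r)"

lemma rowc_simps [simp]: "rowc c b 0 = 0"
  "rowc c b (Suc k) = min (carry c b k + c (Suc k)) (b (Suc k))"
  by (simp_all add: rowc_def)

lemma rowb_simps [simp]: "rowb c b 0 = 0"
  "rowb c b (Suc k) = c (Suc (Suc k)) + b (Suc k) - min (carry c b k + c (Suc k)) (b (Suc k))"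
  by (simp_all add: rowb_def)

lemma lower_apply:
  "lower r f i = (if 0 < r \<and> 0 < f r
     then (if i = 0 then 0 else if i = r then f i - 1 else if Suc i = r then f i + 1 else f i)
     else f i)"
  by (simp add: lower_def)

lemma lower_0 [simp]: "lower 0 f = f" by (simp add: lower_def)
lemma circ_next_0 [simp]: "circ_next 0 f = 0" by (simp add: circ_next_def)
lemma box_next_0 [simp]: "box_next 0 f = 0" by (simp add: box_next_def)
lemma box_next_eq_0 [simp]: "box_next r f = 0 \<longleftrightarrow> r = 0" by (simp add: box_next_def)

lemma carry_eqI:
  assumes "u 0 = 0" "\<And>i. u (Suc i) = u i + c (Suc i) - b (Suc i)"
  shows "carry c b = u"
proof
  show "carry c b i = u i" for i by (induction i) (use assms in auto)
qed

text \<open>The exchange of the two rules at a single row: meeting the old boxed row and then the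
  old circled row has the same effect as meeting the new circled row and then the new boxed row.
  Only one carry can change, by one; the five cases list how.\<close>

lemma row_intertwine:
  fixes c b :: "nat \<Rightarrow> nat" and r :: nat
  defines "r' \<equiv> box_next r b" and "s \<equiv> circ_next r (rowc c b)"
  shows "rowc (lower r' c) (lower r b) = lower r (rowc c b) \<and>
    rowb (lower r' c) (lower r b) = lower s (rowb c b) \<and>
    circ_next r' c = box_next s (rowb c b)"
proof (cases r)
  case 0
  then show ?thesis by (simp add: assms)
next
  case (Suc m)
  let ?u = "carry c b"
  define cl bl where "cl = lower r' c" and "bl = lower r b"
  have cl: "cl i = lower r' c i" and bl: "bl i = lower r b i" for i
    by (simp_all add: cl_def bl_def)
  consider (both) "b r > 0" "c r > 0" | (carried) "b r > 0" "c r = 0" "?u m > 0"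
    | (free) "b r > 0" "c r = 0" "?u m = 0"
    | (right) "b r = 0" "c (Suc r) > 0" | (none) "b r = 0" "c (Suc r) = 0" by blast
  then show ?thesis
  proof cases
    case both
    have r': "r' = r" and s: "s = m"
      using both Suc by (simp_all add: r'_def s_def box_next_def circ_next_def)
    \<comment> \<open>A ball and a cell move together from \<open>r\<close> to \<open>r - 1\<close>
      (or vanish together), so they cancel in every carry.\<close>
    have u: "carry cl bl = ?u"
      by (rule carry_eqI) (use both Suc in \<open>auto simp: lower_apply cl bl r'\<close>)
    have bm: "0 < rowb c b m" if "0 < m" using that Suc both by (cases m) auto
    have "rowc cl bl i = lower r (rowc c b) i" for i
      using both Suc by (cases i) (auto simp: u lower_apply cl bl r')
    moreover have "rowb cl bl i = lower s (rowb c b) i" for i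
      using both Suc bm by (cases i) (auto simp: u s lower_apply cl bl r')
    moreover have "circ_next r' c = box_next s (rowb c b)"
      using bm both Suc by (cases m) (auto simp: r' s circ_next_def box_next_def)
    ultimately show ?thesis unfolding cl_def bl_def by blast
  next
    case carried
    have r': "r' = r" and s: "s = m"
      using carried Suc by (simp_all add: r'_def s_def box_next_def circ_next_def)
    have m0: "0 < m" using carried by (cases m) auto
    \<comment> \<open>The cell moved to \<open>r - 1\<close> catches one of the balls that used to
      be carried on to \<open>r\<close>.\<close>
    have u: "carry cl bl = ?u(m := ?u m - 1)"
      by (rule carry_eqI) (use carried Suc m0 in \<open>auto simp: lower_apply cl bl r'\<close>)
    have bm: "rowb c b m = 0" using carried Suc by (cases m) auto
    obtain k where k: "m = Suc k" using m0 by (cases m) auto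
    have bk: "b m < ?u k + c m" using carried k by auto
    have "rowc cl bl i = lower r (rowc c b) i" for i
      using carried Suc k bk by (cases i) (auto simp: u lower_apply cl bl r')
    moreover have "rowb cl bl i = lower s (rowb c b) i" for i
      using carried Suc bm k bk by (cases i) (auto simp: u s lower_apply cl bl r')
    moreover have "circ_next r' c = box_next s (rowb c b)"
      using bm m0 carried Suc by (auto simp: r' s circ_next_def box_next_def)
    ultimately show ?thesis unfolding cl_def bl_def by blast
  next
    case free
    have r': "r' = r" and s: "s = r"
      using free Suc by (simp_all add: r'_def s_def box_next_def circ_next_def)
    \<comment> \<open>No ball waits after \<open>r - 1\<close>, so the cell moved there stays
      free.\<close>
    have u: "carry cl bl = ?u"
      by (rule carry_eqI) (use free Suc in \<open>auto simp: lower_apply cl bl r'\<close>)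
    have um: "?u k + c (Suc k) \<le> b (Suc k)" if "m = Suc k" for k
      using free that by auto
    have br: "0 < rowb c b r" using free Suc by auto
    have "rowc cl bl i = lower r (rowc c b) i" for i
      using free Suc um by (cases i) (auto simp: u lower_apply cl bl r')
    moreover have "rowb cl bl i = lower s (rowb c b) i" for i
      using free Suc br um by (cases i) (auto simp: u s lower_apply cl bl r')
    moreover have "circ_next r' c = box_next s (rowb c b)"
      using br free Suc by (auto simp: r' s circ_next_def box_next_def)
    ultimately show ?thesis unfolding cl_def bl_def by blast
  next
    case right
    have r': "r' = Suc r" and s: "s = r"
      using right Suc by (simp_all add: r'_def s_def box_next_def circ_next_def)
    \<comment> \<open>A ball moves from \<open>r + 1\<close> to \<open>r\<close>, finds no cell
      there and is carried back to \<open>r + 1\<close>.\<close>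
    have u: "carry cl bl = ?u(r := ?u r + 1)"
      by (rule carry_eqI) (use right Suc in \<open>auto simp: lower_apply cl bl r'\<close>)
    have br: "0 < rowb c b r" using right Suc by auto
    have "rowc cl bl i = lower r (rowc c b) i" for i
      using right Suc by (cases i) (auto simp: u lower_apply cl bl r')
    moreover have "rowb cl bl i = lower s (rowb c b) i" for i
      using right Suc br by (cases i) (auto simp: u s lower_apply cl bl r')
    moreover have "circ_next r' c = box_next s (rowb c b)"
      using br right Suc by (auto simp: r' s circ_next_def box_next_def)
    ultimately show ?thesis unfolding cl_def bl_def by blast
  next
    case none
    then show ?thesis using Suc
      by (auto simp: cl_def bl_def r'_def s_def box_next_def circ_next_def lower_def)
  qed
qed

section \<open>The local rule as a ball-moving process\<close>

text \<open>Number of balls waiting for a free cell just before cell \<open>e\<close>, if only the balls in cells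
  below \<open>k\<close> are moved.\<close>
primrec load :: "(nat \<times> bool) list \<Rightarrow> nat \<Rightarrow> nat \<Rightarrow> nat" where
  "load cs k 0 = 0"
| "load cs k (Suc e) = (if snd (cs ! e) then load cs k e + (if e < k then 1 else 0) else load cs k e - 1)"

lemma load_Suc_below: "e \<le> k \<Longrightarrow> load cs (Suc k) e = load cs k e"
  by (induction e) auto

lemma load_no_ball:
  "\<not> snd (cs ! k) \<Longrightarrow> load cs (Suc k) e = load cs k e"
  by (induction e) (auto simp: less_Suc_eq)

text \<open>The extra ball raises the load until the first empty cell behind it at which no earlier
  ball is waiting; there it is absorbed.\<close>

lemma load_ball:
  assumes "snd (cs ! k)" "Suc k \<le> e"
  shows "load cs (Suc k) e = load cs k e +
    (if \<forall>e'. k < e' \<and> e' < e \<and> \<not> snd (cs ! e') \<longrightarrow> 0 < load cs k e' then 1 else 0)"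
  using assms(2)
proof (induction e rule: dec_induct)
  case base
  then show ?case using assms(1) load_Suc_below[of k k cs] by auto
next
  case (step e)
  let ?P = "\<lambda>e. \<forall>e'. k < e' \<and> e' < e \<and> \<not> snd (cs ! e') \<longrightarrow> 0 < load cs k e'"
  have P: "?P (Suc e) \<longleftrightarrow> ?P e \<and> (snd (cs ! e) \<or> 0 < load cs k e)"
    using Suc_le_lessD[OF step.hyps(1)] by (auto simp: less_Suc_eq)
  show ?case unfolding load.simps step.IH P using step.hyps by auto
qed

text \<open>Moving balls one at a time fills the same cells as letting all balls travel right
  together, each empty cell taking one of them whenever some are waiting.\<close>

lemma receivers_eq:
  "receivers cs = {e. e < length cs \<and> \<not> snd (cs ! e) \<and> 0 < load cs (length cs) e}"
proof -
  define f where "f = (\<lambda>k occ. if snd (cs ! k)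
                   then (case next_free cs occ k of None \<Rightarrow> occ | Some e \<Rightarrow> insert e occ)
                   else occ)"
  define occ where "occ = (\<lambda>k. {e. e < length cs \<and> \<not> snd (cs ! e) \<and> 0 < load cs k e})"
  have "fold f [0..<k] {} = occ k" for k
  proof (induction k)
    case 0
    have "load cs 0 e = 0" for e by (induction e) auto
    then show ?case by (simp add: occ_def)
  next
    case (Suc k)
    have "f k (occ k) = occ (Suc k)"
    proof (cases "snd (cs ! k)")
      case False
      then show ?thesis by (simp add: f_def occ_def load_no_ball)
    next
      case True
      let ?Q = "\<lambda>e. k < e \<and> e < length cs \<and> \<not> snd (cs ! e) \<and> e \<notin> occ k"
      have Q: "?Q e \<longleftrightarrow> k < e \<and> e < length cs \<and> \<not> snd (cs ! e) \<and> load cs k e = 0" for e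
        by (auto simp: occ_def)
      \<comment> \<open>By \<open>load_ball\<close>, the ball in cell \<open>k\<close> adds exactly
        the first free cell to its right, which is the choice made by
        \<open>next_free\<close>.\<close>
      have new: "e \<in> occ (Suc k) \<longleftrightarrow> e \<in> occ k \<or> (?Q e \<and> (\<forall>e'<e. \<not> ?Q e'))" for e
      proof (cases "k < e")
        case False
        then show ?thesis using load_Suc_below[of e k cs] by (auto simp: occ_def)
      next
        case ke: True
        show ?thesis
        proof (cases "e < length cs")
          case el: True
          have "(\<forall>e'. k < e' \<and> e' < e \<and> \<not> snd (cs ! e') \<longrightarrow> 0 < load cs k e') \<longleftrightarrow> (\<forall>e'<e. \<not> ?Q e')"
            unfolding Q using el by auto
          with load_ball[OF True, of e] ke have
            "load cs (Suc k) e = load cs k e + (if \<forall>e'<e. \<not> ?Q e' then 1 else 0)" by simp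
          then show ?thesis using ke el unfolding Q by (cases "load cs k e = 0"; cases "snd (cs ! e)") (auto simp: occ_def)
        qed (simp add: occ_def)
      qed
      show ?thesis
      proof (cases "\<exists>e. ?Q e")
        case False
        then have "next_free cs (occ k) k = None" by (simp add: next_free_def)
        moreover have "occ (Suc k) = occ k" using new False by blast
        ultimately show ?thesis using True by (simp add: f_def)
      next
        case ex: True
        define m where "m = (LEAST e. ?Q e)"
        have m: "?Q m" "\<And>e. e < m \<Longrightarrow> \<not> ?Q e"
          using LeastI_ex[OF ex] not_less_Least unfolding m_def by blast+
        have "next_free cs (occ k) k = Some m" using ex unfolding next_free_def m_def by simp
        moreover have "occ (Suc k) = insert m (occ k)"
        proof -
          have "?Q e \<and> (\<forall>e'<e. \<not> ?Q e') \<longleftrightarrow> e = m" for e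
            using m by (meson linorder_neqE_nat)
          then show ?thesis using new by blast
        qed
        ultimately show ?thesis using True by (simp add: f_def)
      qed
    qed
    then show ?case using Suc.IH by simp
  qed
  then show ?thesis unfolding receivers_def f_def[symmetric] by (simp add: occ_def)
qed

text \<open>A single pass from left to right that outputs the new cells; \<open>u\<close> is the
  number of waiting balls.\<close>

fun scan :: "nat \<Rightarrow> (nat \<times> bool) list \<Rightarrow> (nat \<times> bool) list" where
  "scan u [] = []"
| "scan u ((v, True) # cs) = (v - 1, False) # scan (Suc u) cs"
| "scan u ((v, False) # cs) = (v, 0 < u) # scan (u - 1) cs"

fun scan_load :: "nat \<Rightarrow> (nat \<times> bool) list \<Rightarrow> nat" where
  "scan_load u [] = u"
| "scan_load u ((v, True) # cs) = scan_load (Suc u) cs"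
| "scan_load u ((v, False) # cs) = scan_load (u - 1) cs"

lemma scan_append: "scan u (xs @ ys) = scan u xs @ scan (scan_load u xs) ys"
  by (induction u xs rule: scan.induct) auto

lemma scan_load_append: "scan_load u (xs @ ys) = scan_load (scan_load u xs) ys"
  by (induction u xs rule: scan.induct) auto

lemma scan_balls [simp]: "scan u (replicate n (v, True)) = replicate n (v - 1, False)"
  by (induction n arbitrary: u) auto

lemma scan_load_balls [simp]: "scan_load u (replicate n (v, True)) = u + n"
  by (induction n arbitrary: u) auto

lemma scan_load_cells [simp]: "scan_load u (replicate n (v, False)) = u - n"
  by (induction n arbitrary: u) auto

lemma scan_cells [simp]:
  "scan u (replicate n (v, False)) = replicate (min u n) (v, True) @ replicate (n - u) (v, False)"
proof (induction n arbitrary: u)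
  case (Suc n)
  then show ?case by (cases u) (auto simp: replicate_append_same)
qed simp

lemma scan_eq_map:
  "map (\<lambda>k. if snd (cs ! k) then (fst (cs ! k) - 1, False)
        else if k \<in> receivers cs then (fst (cs ! k), True)
        else (fst (cs ! k), False)) [0..<length cs] = scan 0 cs"
proof -
  let ?g = "\<lambda>k. if snd (cs ! k) then (fst (cs ! k) - 1, False)
        else if k \<in> receivers cs then (fst (cs ! k), True)
        else (fst (cs ! k), False)"
  \<comment> \<open>Generalized to suffixes: the pass reaches cell \<open>e\<close> with
    \<open>load cs (length cs) e\<close> waiting balls.\<close>
  have "map ?g [e..<length cs] = scan (load cs (length cs) e) (drop e cs)" if "e \<le> length cs" for e
    using that
  proof (induction e rule: inc_induct)
    case base
    then show ?case by simp
  next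
    case (step e)
    obtain v t where vt: "cs ! e = (v, t)" by fastforce
    have d: "drop e cs = (v, t) # drop (Suc e) cs"
      using step.hyps vt by (metis Cons_nth_drop_Suc)
    show ?case using step vt unfolding d upt_conv_Cons[OF step.hyps(2)]
      by (cases t) (auto simp: receivers_eq)
  qed
  from this[of 0] show ?thesis by simp
qed

primrec blocks :: "(nat \<Rightarrow> nat) \<Rightarrow> (nat \<Rightarrow> nat) \<Rightarrow> nat \<Rightarrow> (nat \<times> bool) list" where
  "blocks c b 0 = []"
| "blocks c b (Suc n) =
     blocks c b n @ replicate (c (Suc n)) (Suc n, True) @ replicate (b (Suc n)) (Suc n, False)"

lemma count_replicate_mset_if: "count (mset (replicate n x)) y = (if x = y then n else 0)"
  by (induction n) auto

lemma count_blocks: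
  "count (mset (blocks c b n)) (v, t) = (if 1 \<le> v \<and> v \<le> n then (if t then c v else b v) else 0)"
  by (induction n) (auto simp: count_replicate_mset_if)

lemma blocks_bound: "p \<in> set (blocks c b n) \<Longrightarrow> fst p \<le> n"
  by (induction n) auto

lemma sorted_blocks: "sorted (map (\<lambda>(v, t). 2 * v + (if t then 0 else 1)) (blocks c b n))"
proof (induction n)
  case (Suc n)
  have "(case p of (v, t) \<Rightarrow> 2 * v + (if t then 0 else 1)) \<le> Suc (2 * n)" if "p \<in> set (blocks c b n)" for p
    using blocks_bound[OF that] by (auto split: prod.splits)
  with Suc show ?case by (fastforce simp: sorted_append sorted_replicate)
qed simp

abbreviation cnt :: "nat list \<Rightarrow> nat \<Rightarrow> nat" where
  "cnt xs \<equiv> count (mset xs)"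

lemma count_tagged: "count {#(v, s). v \<in># M#} (v, t) = (if s = t then count M v else 0)"
  by (induction M) auto

text \<open>The sorting key separates any two different cells, so the sorted list depends only on
  the multiset of cells.\<close>

lemma merge_cells_blocks:
  assumes "0 \<notin> set c" "0 \<notin> set x" "\<forall>v\<in>set c \<union> set x. v \<le> n"
  shows "merge_cells c x = blocks (cnt c) (cnt x) n"
  unfolding merge_cells_def
proof (rule sort_key_inj_key_eq)
  have "count (mset (map (\<lambda>v. (v, True)) c @ map (\<lambda>v. (v, False)) x)) (v, t)
      = count (mset (blocks (cnt c) (cnt x) n)) (v, t)" for v t
  proof -
    have "cnt c v = 0 \<and> cnt x v = 0" if "\<not> (1 \<le> v \<and> v \<le> n)"
      using that assms by (cases "v = 0") (auto simp: count_eq_zero_iff)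
    then show ?thesis by (simp add: count_blocks count_tagged)
  qed
  then show "mset (map (\<lambda>v. (v, True)) c @ map (\<lambda>v. (v, False)) x) = mset (blocks (cnt c) (cnt x) n)"
    by (metis multiset_eqI surj_pair)
  show "inj_on (\<lambda>(v, b). 2 * v + (if b then 0 else 1))
     (set (map (\<lambda>v. (v, True)) c @ map (\<lambda>v. (v, False)) x))"
    by (auto simp: inj_on_def split: if_splits) presburger+
qed (rule sorted_blocks)

lemma scan_load_blocks: "scan_load 0 (blocks c b n) = carry c b n"
  by (induction n) (auto simp: scan_load_append)

lemma count_scan_circled:
  "cnt (map fst (filter snd (scan 0 (blocks c b n)))) i = (if i \<le> n then rowc c b i else 0)"
proof (induction n)
  case 0 then show ?case by simp
next
  case (Suc n)
  then show ?case
    by (auto simp: scan_append scan_load_blocks count_replicate_mset_if le_Suc_eq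
      scan_load_append)
qed

text \<open>The value 0 is excluded because balls of value 1 leave boxed zeros, which are deleted
  only after the pass.\<close>

lemma count_scan_boxed:
  "0 < i \<Longrightarrow> cnt (map fst (filter (\<lambda>p. \<not> snd p) (scan 0 (blocks c b n)))) i =
     (if i \<le> n then b i - rowc c b i else 0) + (if Suc i \<le> n then c (Suc i) else 0)"
proof (induction n)
  case 0 then show ?case by simp
next
  case (Suc n)
  then show ?case
    by (auto simp: scan_append scan_load_blocks count_replicate_mset_if le_Suc_eq
      scan_load_append)
qed

lemma rowc_le: "rowc c b i \<le> b i"
  by (cases i) auto

lemma row_step_counts:
  assumes "0 \<notin> set c" "0 \<notin> set x"
  shows "cnt (fst (row_step c x)) = rowc (cnt c) (cnt x)"
    and "cnt (snd (row_step c x)) = rowb (cnt c) (cnt x)"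
proof -
  define n where "n = Max (set c \<union> set x \<union> {0})"
  have n: "\<forall>v\<in>set c \<union> set x. v \<le> n" by (auto simp: n_def)
  have zero: "cnt c v = 0" "cnt x v = 0" if "n < v" for v
    using n that by (force simp: count_eq_zero_iff)+
  have m: "merge_cells c x = blocks (cnt c) (cnt x) n"
    by (rule merge_cells_blocks[OF assms n])
  have step: "row_step c x = (let new = scan 0 (blocks (cnt c) (cnt x) n) in
      (sort (map fst (filter snd new)),
       sort (filter (\<lambda>v. v \<noteq> 0) (map fst (filter (\<lambda>p. \<not> snd p) new)))))"
    unfolding row_step_def Let_def scan_eq_map m ..
  show "cnt (fst (row_step c x)) = rowc (cnt c) (cnt x)"
  proof
    fix i
    show "cnt (fst (row_step c x)) i = rowc (cnt c) (cnt x) i"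
      using zero(2)[of i] rowc_le[of "cnt c" "cnt x" i]
      unfolding step Let_def fst_conv mset_sort count_scan_circled
      by (cases "i \<le> n") (auto simp del: count_mset_0_iff)
  qed
  show "cnt (snd (row_step c x)) = rowb (cnt c) (cnt x)"
  proof
    fix i
    show "cnt (snd (row_step c x)) i = rowb (cnt c) (cnt x) i"
    proof (cases i)
      case 0 then show ?thesis unfolding step by (simp add: Let_def)
    next
      case (Suc k)
      have "cnt (snd (row_step c x)) i = cnt (map fst (filter (\<lambda>p. \<not> snd p) (scan 0 (blocks (cnt c) (cnt x) n)))) i"
        unfolding step Let_def snd_conv mset_sort using Suc by (simp add: mset_filter)
      also have "\<dots> = rowb (cnt c) (cnt x) i"
        using zero[of i] zero[of "Suc i"] Suc by (subst count_scan_boxed) (auto simp del: count_mset_0_iff)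
      finally show ?thesis .
    qed
  qed
qed

lemma row_step_sorted: "sorted (fst (row_step c x))" "sorted (snd (row_step c x))"
  by (simp_all add: row_step_def Let_def)

section \<open>Infinite arrays and chains of shapes\<close>

type_synonym array = "nat \<Rightarrow> nat \<Rightarrow> nat"

primrec boxed :: "array \<Rightarrow> (nat \<Rightarrow> nat) \<Rightarrow> nat \<Rightarrow> nat \<Rightarrow> nat" where
  "boxed C b 0 = b"
| "boxed C b (Suc p) = rowb (C p) (boxed C b p)"

text \<open>No row is appended: the boxed row travels on through all rows. Agreement with the finite
  action therefore needs control of what arrives at the last row.\<close>

definition iact :: "array \<Rightarrow> (nat \<Rightarrow> nat) \<Rightarrow> array" where
  "iact C b = (\<lambda>p. rowc (C p) (boxed C b p))"

primrec trail :: "array \<Rightarrow> nat \<Rightarrow> nat \<Rightarrow> nat" where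
  "trail C r 0 = r"
| "trail C r (Suc p) = circ_next (trail C r p) (C p)"

definition pass :: "array \<Rightarrow> nat \<Rightarrow> array" where
  "pass C r = (\<lambda>p. lower (trail C r p) (C p))"

text \<open>\<open>row_intertwine\<close> applied row by row. Since \<open>box_next\<close> neither
  creates nor destroys 0, both trails reach 0 at the same row.\<close>

lemma iact_intertwine:
  fixes r :: nat and b :: "nat \<Rightarrow> nat"
  defines "r' \<equiv> box_next r b"
  shows "iact (pass C r') (lower r b) = pass (iact C b) r"
    and "trail C r' p = 0 \<longleftrightarrow> trail (iact C b) r p = 0"
proof -
  have inv: "boxed (pass C r') (lower r b) p = lower (trail (iact C b) r p) (boxed C b p) \<and>
    trail C r' p = box_next (trail (iact C b) r p) (boxed C b p)" for p
  proof (induction p)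
    case 0
    then show ?case by (simp add: r'_def)
  next
    case (Suc p)
    then show ?case
      using row_intertwine[of "trail (iact C b) r p" "boxed C b p" "C p"]
      by (simp add: pass_def iact_def)
  qed
  show "iact (pass C r') (lower r b) = pass (iact C b) r"
  proof
    fix p
    show "iact (pass C r') (lower r b) p = pass (iact C b) r p"
      using inv[of p] row_intertwine[of "trail (iact C b) r p" "boxed C b p" "C p"]
      by (simp add: pass_def iact_def)
  qed
  show "trail C r' p = 0 \<longleftrightarrow> trail (iact C b) r p = 0" using inv[of p] by simp
qed

text \<open>Insertion undoes a step. If the number passed on is 0, a copy of 1 was deleted; if it is
  \<open>s > 0\<close>, the changed row contains \<open>s\<close> exactly when a copy was
  lowered.\<close>

lemma lower_circ_inj:
  assumes "circ_next r1 c1 = circ_next r2 c2" "lower r1 c1 = lower r2 c2"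
    "0 < r1" "0 < r2" "c1 0 = 0" "c2 0 = 0"
  shows "r1 = r2 \<and> c1 = c2"
proof -
  have eq: "lower r1 c1 i = lower r2 c2 i" for i using assms(2) by simp
  have r: "r1 = r2"
  proof (rule ccontr)
    assume "r1 \<noteq> r2"
    then show False
      using assms(1,3,4) eq[of r1] eq[of r2]
      by (auto simp: circ_next_def lower_apply split: if_splits)
  qed
  moreover have "c1 i = c2 i" for i
    using assms(1,3-6) eq[of i] unfolding r
    by (cases "i = 0"; cases "i = r2"; cases "Suc i = r2"; cases "c1 r2 = 0"; cases "c2 r2 = 0")
      (auto simp: circ_next_def lower_apply)
  ultimately show ?thesis by blast
qed

text \<open>Insertion runs backwards from row \<open>k\<close>, where both trails have become 0; the
  rows from \<open>k\<close> on were not changed at all.\<close>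

lemma pass_inj:
  assumes "pass C1 r1 = pass C2 r2"
    and "\<And>p. trail C1 r1 p = 0 \<longleftrightarrow> k \<le> p" "\<And>p. trail C2 r2 p = 0 \<longleftrightarrow> k \<le> p"
    and "\<And>p. C1 p 0 = 0" "\<And>p. C2 p 0 = 0"
  shows "C1 = C2"
proof
  fix p
  have low: "lower (trail C1 r1 p) (C1 p) = lower (trail C2 r2 p) (C2 p)" for p
    using fun_cong[OF assms(1), of p] by (simp add: pass_def)
  have tr: "trail C1 r1 p = trail C2 r2 p" if "p \<le> k" for p
    using that
  proof (induction p rule: inc_induct)
    case base
    show ?case using assms(2)[of k] assms(3)[of k] by simp
  next
    case (step p)
    then have "0 < trail C1 r1 p" "0 < trail C2 r2 p" using assms(2,3) by (metis gr0I not_le)+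
    then show ?case using step.IH lower_circ_inj[OF _ low] assms(4,5) by simp
  qed
  show "C1 p = C2 p"
  proof (cases "p < k")
    case True
    then have "0 < trail C1 r1 p" "0 < trail C2 r2 p" using assms(2,3) by (metis gr0I not_le)+
    moreover have "circ_next (trail C1 r1 p) (C1 p) = circ_next (trail C2 r2 p) (C2 p)"
      using tr[of "Suc p"] True by simp
    ultimately show ?thesis using lower_circ_inj[OF _ low] assms(4,5) by blast
  next
    case False
    then show ?thesis using low[of p] assms(2,3)[of p] by simp
  qed
qed

text \<open>For weakly decreasing row lengths, the entry \<open>i\<close> of row \<open>p\<close>
  stands for a column of height \<open>i + p\<close>: a column of height \<open>h\<close>
  contributes \<open>h - p\<close> to each row \<open>p < h\<close>.\<close>

definition stair :: "(nat \<Rightarrow> nat) \<Rightarrow> array" where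
  "stair l = (\<lambda>p i. case i of 0 \<Rightarrow> 0 | Suc k \<Rightarrow> l (k + p) - l (Suc k + p))"

definition wfun :: "(nat \<Rightarrow> nat \<Rightarrow> nat) \<Rightarrow> nat \<Rightarrow> nat \<Rightarrow> nat" where
  "wfun l j i = (case i of 0 \<Rightarrow> 0 | Suc k \<Rightarrow> l j k - l (Suc j) (Suc k))"

lemma stair_simps [simp]: "stair l p 0 = 0" "stair l p (Suc k) = l (k + p) - l (Suc k + p)"
  by (simp_all add: stair_def)

lemma wfun_simps [simp]: "wfun l j 0 = 0" "wfun l j (Suc k) = l j k - l (Suc j) (Suc k)"
  by (simp_all add: wfun_def)

text \<open>The start \<open>stair (l M)\<close> replaces the one-rowed arrays of level
  \<open>M\<close> and above: these are all equal and build up the staircase row by row.\<close>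

definition arr :: "(nat \<Rightarrow> nat \<Rightarrow> nat) \<Rightarrow> nat \<Rightarrow> nat \<Rightarrow> array" where
  "arr l M j = foldr (\<lambda>j C. iact C (wfun l j)) [j..<M] (stair (l M))"

lemma arr_top: "arr l M M = stair (l M)" by (simp add: arr_def)

lemma arr_step: "j < M \<Longrightarrow> arr l M j = iact (arr l M (Suc j)) (wfun l j)"
  by (simp add: arr_def upt_conv_Cons)

lemma arr_0: "j \<le> M \<Longrightarrow> arr l M j p 0 = 0"
  by (cases "j = M") (auto simp: arr_top arr_step iact_def)

text \<open>Row lengths of the chain of shapes given by the boxes with entry at most \<open>j\<close>.\<close>
definition strips :: "nat \<Rightarrow> nat \<Rightarrow> (nat \<Rightarrow> nat \<Rightarrow> nat) \<Rightarrow> bool" where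
  "strips L M l \<longleftrightarrow> (\<forall>j r. l j r \<le> l (Suc j) r) \<and> (\<forall>j r. l (Suc j) (Suc r) \<le> l j r) \<and>
     (\<forall>j\<ge>M. l j = l M) \<and> (\<forall>j. \<forall>r\<ge>L. l j r = 0)"

lemma stripsD:
  assumes "strips L M l"
  shows "l j r \<le> l (Suc j) r" "l (Suc j) (Suc r) \<le> l j r" "M \<le> j \<Longrightarrow> l j = l M" "L \<le> r \<Longrightarrow> l j r = 0"
  using assms unfolding strips_def by blast+

lemma strips_antimono: "strips L M l \<Longrightarrow> l j (Suc r) \<le> l j r"
  by (meson stripsD(1,2) le_trans)

text \<open>The row, counted from 0, in which level \<open>j\<close> loses its last box. For
  interlacing shapes the test says that \<open>wfun l j\<close> vanishes at
  \<open>Suc (hole l a j)\<close>.\<close>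

primrec hole :: "(nat \<Rightarrow> nat \<Rightarrow> nat) \<Rightarrow> nat \<Rightarrow> nat \<Rightarrow> nat" where
  "hole l a 0 = a"
| "hole l a (Suc j) = (if l (Suc j) (Suc (hole l a j)) = l j (hole l a j) then Suc (hole l a j) else hole l a j)"

definition slid :: "(nat \<Rightarrow> nat \<Rightarrow> nat) \<Rightarrow> nat \<Rightarrow> nat \<Rightarrow> nat \<Rightarrow> nat" where
  "slid l a j r = (if r = hole l a j then l j r - 1 else l j r)"

text \<open>Interlacing hands the corner condition on to the next level, whether the hole moves down
  or stays.\<close>

lemma hole_corner:
  assumes "strips L M l" "l 0 (Suc a) < l 0 a"
  shows "l j (Suc (hole l a j)) < l j (hole l a j)"
proof (induction j)
  case 0
  then show ?case using assms by simp
next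
  case (Suc j)
  let ?h = "hole l a j"
  have 1: "l (Suc j) (Suc ?h) \<le> l j ?h" "l j ?h \<le> l (Suc j) ?h" "l (Suc j) (Suc (Suc ?h)) \<le> l j (Suc ?h)"
    using stripsD[OF assms(1)] by blast+
  show ?case using 1 Suc by auto
qed

lemma hole_stable:
  assumes "strips L M l" "l 0 (Suc a) < l 0 a" "M \<le> j"
  shows "hole l a j = hole l a M"
  using assms(3)
proof (induction j rule: dec_induct)
  case (step j)
  have "l (Suc j) = l j"
    using stripsD(3)[OF assms(1), of j] stripsD(3)[OF assms(1), of "Suc j"] step.hyps by simp
  then show ?case using hole_corner[OF assms(1,2), of j] step.IH by simp
qed simp

lemma strips_slid:
  assumes "strips L M l" "l 0 (Suc a) < l 0 a"
  shows "strips L M (slid l a)"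
proof -
  have c: "l j (Suc (hole l a j)) < l j (hole l a j)" for j using hole_corner[OF assms] .
  have s: "l j r \<le> l (Suc j) r" "l (Suc j) (Suc r) \<le> l j r" "M \<le> j \<Longrightarrow> l j = l M" "L \<le> r \<Longrightarrow> l j r = 0" for j r
    using stripsD[OF assms(1)] by blast+
  have "slid l a j r \<le> slid l a (Suc j) r" for j r
    using s(1)[of j r] s(1)[of j "Suc (hole l a j)"] c[of j] s(2)[of j "hole l a j"]
      s(1)[of j "hole l a j"]
    by (auto simp: slid_def)
  moreover have "slid l a (Suc j) (Suc r) \<le> slid l a j r" for j r
    using s(2)[of j r] s(2)[of j "hole l a j"] c[of j] by (auto simp: slid_def)
  moreover have "slid l a j = slid l a M" if "M \<le> j" for j
    using s(3)[OF that] hole_stable[OF assms that] by (simp add: slid_def fun_eq_iff)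
  moreover have "slid l a j r = 0" if "L \<le> r" for j r
    using s(4)[OF that, of j] by (auto simp: slid_def)
  ultimately show ?thesis unfolding strips_def by blast
qed

text \<open>The slide seen by the local rule; \<open>Suc\<close> turns rows counted from 0 into
  entries counted from 1. If the hole moves down, the two lost boxes cancel in the
  difference.\<close>

lemma wfun_slid:
  assumes "strips L M l" "l 0 (Suc a) < l 0 a"
  shows "wfun (slid l a) j = lower (Suc (hole l a j)) (wfun l j)"
    and "box_next (Suc (hole l a j)) (wfun l j) = Suc (hole l a (Suc j))"
proof -
  let ?h = "hole l a j"
  have s: "l (Suc j) (Suc r) \<le> l j r" for r using stripsD(2)[OF assms(1)] .
  have c: "l j (Suc ?h) < l j ?h" "l (Suc j) (Suc (hole l a (Suc j))) < l (Suc j) (hole l a (Suc j))"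
    using hole_corner[OF assms] by blast+
  show "box_next (Suc ?h) (wfun l j) = Suc (hole l a (Suc j))"
    using s[of ?h] by (auto simp: box_next_def)
  show "wfun (slid l a) j = lower (Suc ?h) (wfun l j)"
  proof
    fix i
    show "wfun (slid l a) j i = lower (Suc ?h) (wfun l j) i"
    proof (cases i)
      case 0
      then show ?thesis by (simp add: lower_apply)
    next
      case (Suc k)
      show ?thesis
      proof (cases "?h = Suc k")
        case True
        then show ?thesis
          using s[of ?h] s[of k] c Suc by (auto simp: lower_apply slid_def)
      next
        case False
        then show ?thesis
          using s[of ?h] s[of k] c Suc by (auto simp: lower_apply slid_def)
      qed
    qed
  qed
qed

text \<open>A column of height \<open>h + 1\<close> loses its last box, so its entry in every row
  \<open>p \<le> h\<close> drops by one.\<close>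

lemma stair_slid:
  assumes "l (Suc h) < l h" "\<And>r. l (Suc r) \<le> l r"
  shows "trail (stair l) (Suc h) p = Suc h - p"
    and "pass (stair l) (Suc h) = stair (\<lambda>r. if r = h then l r - 1 else l r)"
proof -
  have tr: "trail (stair l) (Suc h) p = Suc h - p" for p
  proof (induction p)
    case (Suc p)
    show ?case
    proof (cases "p \<le> h")
      case True
      then have "Suc h - p = Suc (h - p)" by simp
      then show ?thesis using Suc True assms(1) by (simp add: circ_next_def)
    qed (use Suc in simp)
  qed simp
  show "trail (stair l) (Suc h) p = Suc h - p" by (rule tr)
  show "pass (stair l) (Suc h) = stair (\<lambda>r. if r = h then l r - 1 else l r)"
  proof (intro ext)
    fix p i
    show "pass (stair l) (Suc h) p i = stair (\<lambda>r. if r = h then l r - 1 else l r) p i"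
    proof (cases i)
      case 0
      then show ?thesis by (simp add: pass_def lower_apply)
    next
      case (Suc k)
      have 1: "l (Suc (k + p)) \<le> l (k + p)" by (rule assms(2))
      consider "h < p" | "p \<le> h" by linarith
      then show ?thesis
      proof cases
        case 1
        then show ?thesis using Suc by (auto simp: pass_def tr)
      next
        case 2
        then obtain d where h: "h = d + p" by (metis le_add_diff_inverse2)
        have t: "trail (stair l) (Suc h) p = Suc d" using tr[of p] h by simp
        have d: "0 < stair l p (Suc d)" using assms(1) h by simp
        consider "k = d" | "Suc k = d" | "k \<noteq> d" "Suc k \<noteq> d" by blast
        then show ?thesis
          using d assms(1) \<open>l (Suc (k + p)) \<le> l (k + p)\<close> Suc h
          by cases (auto simp: pass_def t[unfolded h] lower_apply)
      qed
    qed
  qed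
qed

text \<open>Downward induction on the level, with \<open>stair_slid\<close> at \<open>M\<close> and
  \<open>iact_intertwine\<close> below. At \<open>j = 0\<close> the array and the corner row
  \<open>a\<close> determine the outer row that loses a box.\<close>

lemma arr_slid:
  assumes "strips L M l" "l 0 (Suc a) < l 0 a" "j \<le> M"
  shows "pass (arr l M j) (Suc (hole l a j)) = arr (slid l a) M j
    \<and> (\<forall>p. trail (arr l M j) (Suc (hole l a j)) p = 0 \<longleftrightarrow> hole l a M < p)"
  using assms(3)
proof (induction j rule: inc_induct)
  case base
  have e: "slid l a M = (\<lambda>r. if r = hole l a M then l M r - 1 else l M r)"
    by (simp add: slid_def fun_eq_iff)
  show ?case
    using stair_slid[of "l M" "hole l a M", OF hole_corner[OF assms(1,2)] strips_antimono[OF assms(1)]]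
    by (auto simp: arr_top e)
next
  case (step j)
  show ?case
    using iact_intertwine[of "arr l M (Suc j)" "Suc (hole l a j)" "wfun l j"] step
      wfun_slid[OF assms(1,2), of j]
    by (simp add: arr_step)
qed

text \<open>\<open>Y p\<close> is a chain of shapes whose \<open>p\<close>-th step has \<open>C p i\<close> boxes in
  row \<open>i - 1\<close>, since row lengths are indexed from 0 and array entries from 1.\<close>
definition chain :: "nat \<Rightarrow> (nat \<Rightarrow> nat) \<Rightarrow> array \<Rightarrow> bool" where
  "chain L y C \<longleftrightarrow> (\<exists>Y. Y 0 = y \<and> (\<forall>p i. C p (Suc i) + Y (Suc p) i = Y p i) \<and>
     (\<forall>p i. Y p (Suc i) \<le> Y (Suc p) i) \<and> (\<forall>p\<ge>L. \<forall>i. Y p i = 0))"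

text \<open>At each row the entries are conserved up to the shift by one, so the boxed rows define a
  second chain squeezed under the first. It has ended at \<open>L\<close> too, and then the boxed
  row is empty.\<close>

lemma chain_iact:
  assumes "chain L y C" "\<And>i. b (Suc i) + y (Suc i) = z i" "\<And>i. z i \<le> y i"
  shows "chain L z (iact C b)" "boxed C b L (Suc i) = 0"
proof -
  obtain Y where Y: "Y 0 = y" "\<And>p i. C p (Suc i) + Y (Suc p) i = Y p i"
     "\<And>p i. Y p (Suc i) \<le> Y (Suc p) i" "\<And>p i. L \<le> p \<Longrightarrow> Y p i = 0"
    using assms(1) unfolding chain_def by blast
  define Z where "Z = (\<lambda>p i. boxed C b p (Suc i) + Y p (Suc i))"
  have Z0: "Z 0 = z" using assms(2) Y(1) by (simp add: Z_def fun_eq_iff)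
  have ZC: "iact C b p (Suc i) + Z (Suc p) i = Z p i" for p i
    using Y(2)[of p "Suc i"] by (simp add: Z_def iact_def)
  have ZY: "Z p i \<le> Y p i" for p i
  proof (induction p arbitrary: i)
    case 0
    then show ?case using Z0 Y(1) assms(3) by simp
  next
    case (Suc p)
    have "Z p i - Y (Suc p) i \<le> iact C b p (Suc i)"
      using Suc.IH[of i] Y(2)[of p i] Y(3)[of p i] by (auto simp: iact_def Z_def)
    then show ?case using ZC[of p i] by linarith
  qed
  have ZZ: "Z p (Suc i) \<le> Z (Suc p) i" for p i
  proof -
    have "Y p (Suc i) \<le> Z (Suc p) i" using Y(2)[of p "Suc i"] by (auto simp: Z_def)
    then show ?thesis using ZY[of p "Suc i"] by linarith
  qed
  have Zend: "Z p i = 0" if "L \<le> p" for p i using ZY[of p i] Y(4)[OF that, of i] by simp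
  show "chain L z (iact C b)" unfolding chain_def
    by (rule exI[of _ Z]) (use Z0 ZC ZZ Zend in blast)
  show "boxed C b L (Suc i) = 0" using Zend[of L i] by (simp add: Z_def)
qed

lemma chain_arr:
  assumes "strips L M l" "j \<le> M"
  shows "chain L (l j) (arr l M j)"
  using assms(2)
proof (induction j rule: inc_induct)
  case base
  \<comment> \<open>Deleting the first row again and again leads from the outer shape to the empty
    one.\<close>
  show ?case unfolding chain_def arr_top
    by (rule exI[of _ "\<lambda>p i. l M (i + p)"])
      (use stripsD(4)[OF assms(1)] strips_antimono[OF assms(1)] in \<open>auto\<close>)
next
  case (step j)
  show ?case unfolding arr_step[OF step.hyps(2)]
    by (rule chain_iact(1)[OF step.IH]) (use stripsD(1,2)[OF assms(1)] in \<open>auto\<close>)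
qed

lemma chain_zero: "chain L y C \<Longrightarrow> L \<le> p \<Longrightarrow> C p (Suc i) = 0"
  unfolding chain_def by (metis add_is_0)

text \<open>This makes the array of a straight shape empty, which starts the induction along the
  rectification.\<close>

lemma chain_empty: "chain L (\<lambda>_. 0) C \<Longrightarrow> C p (Suc i) = 0"
proof -
  assume "chain L (\<lambda>_. 0) C"
  then obtain Y where Y: "Y 0 = (\<lambda>_. 0)" "\<And>p i. C p (Suc i) + Y (Suc p) i = Y p i"
    unfolding chain_def by blast
  have "Y p i = 0" for p i
  proof (induction p arbitrary: i)
    case (Suc p) then show ?case using Y(2)[of p i] by simp
  qed (simp add: Y)
  then show ?thesis using Y(2)[of p i] by simp
qed

section \<open>Stabilization of the circled array\<close>

text \<open>\<open>boxed\<close> recurses at the last row and \<open>act\<close> at the first; this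
  equation mediates between them.\<close>

lemma boxed_shift: "boxed C b (Suc p) = boxed (\<lambda>p. C (Suc p)) (rowb (C 0) b) p"
  by (induction p) auto

definition reduced_row :: "nat list \<Rightarrow> bool" where
  "reduced_row r \<longleftrightarrow> sorted r \<and> 0 \<notin> set r"

lemma reduced_row_step:
  assumes "reduced_row c" "reduced_row x"
  shows "reduced_row (fst (row_step c x))" "reduced_row (snd (row_step c x))"
proof -
  note counts = row_step_counts[of c x]
  have "cnt (fst (row_step c x)) 0 = 0" "cnt (snd (row_step c x)) 0 = 0"
    using counts assms by (simp_all add: reduced_row_def del: count_mset_0_iff)
  then show "reduced_row (fst (row_step c x))" "reduced_row (snd (row_step c x))"
    using row_step_sorted[of c x] by (simp_all add: reduced_row_def)
qed

lemma good_act: "\<forall>r\<in>set C. reduced_row r \<Longrightarrow> reduced_row x \<Longrightarrow> \<forall>r\<in>set (act C x). reduced_row r"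
proof (induction C arbitrary: x)
  case (Cons c C)
  obtain c' x' where rs: "row_step c x = (c', x')" by fastforce
  then have "reduced_row c'" "reduced_row x'"
    using reduced_row_step[of c x] Cons.prems by auto
  moreover have "\<forall>r\<in>set (act C x'). reduced_row r"
    by (rule Cons.IH) (use Cons.prems \<open>reduced_row x'\<close> in auto)
  ultimately show ?case by (simp add: rs)
qed simp

lemma length_act [simp]: "length (act C x) = Suc (length C)"
  by (induction C arbitrary: x) (auto split: prod.splits)

lemma act_counts:
  assumes "\<forall>r\<in>set C. reduced_row r" "reduced_row x" "\<forall>p<length C. cnt (C ! p) = Cf p"
  shows "p < length C \<Longrightarrow> cnt (act C x ! p) = iact Cf (cnt x) p"
    and "cnt (act C x ! length C) = boxed Cf (cnt x) (length C)"
proof -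
  have "(\<forall>p<length C. cnt (act C x ! p) = iact Cf (cnt x) p) \<and>
      cnt (act C x ! length C) = boxed Cf (cnt x) (length C)"
    using assms
  proof (induction C arbitrary: x Cf)
    case Nil
    then show ?case by simp
  next
    case (Cons c C)
    obtain c' x' where rs: "row_step c x = (c', x')" by fastforce
    have c: "reduced_row c" "cnt c = Cf 0" using Cons.prems by auto
    have x': "reduced_row x'" using reduced_row_step(2)[OF c(1) Cons.prems(2)] rs by simp
    have C: "\<forall>r\<in>set C. reduced_row r" and Cf: "\<forall>p<length C. cnt (C ! p) = Cf (Suc p)"
      using Cons.prems by auto
    have counts: "cnt c' = rowc (Cf 0) (cnt x)" "cnt x' = rowb (Cf 0) (cnt x)"
      using row_step_counts[of c x] c Cons.prems(2) rs by (auto simp: reduced_row_def)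
    have IH: "\<forall>p<length C. cnt (act C x' ! p) = iact (\<lambda>p. Cf (Suc p)) (cnt x') p"
      "cnt (act C x' ! length C) = boxed (\<lambda>p. Cf (Suc p)) (cnt x') (length C)"
      using Cons.IH[OF C x' Cf] by blast+
    have "cnt (act (c # C) x ! p) = iact Cf (cnt x) p" if "p < Suc (length C)" for p
      using that IH(1) counts boxed_shift[of Cf "cnt x"]
      by (cases p) (simp_all add: rs iact_def)
    moreover have "cnt (act (c # C) x ! Suc (length C)) = boxed Cf (cnt x) (Suc (length C))"
      using IH(2) counts boxed_shift[of Cf "cnt x"] by (simp add: rs)
    ultimately show ?case by simp
  qed
  then show "p < length C \<Longrightarrow> cnt (act C x ! p) = iact Cf (cnt x) p"
    and "cnt (act C x ! length C) = boxed Cf (cnt x) (length C)" by auto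
qed

definition represents :: "nat list list \<Rightarrow> array \<Rightarrow> bool" where
  "represents D Cf \<longleftrightarrow> (\<forall>r\<in>set D. reduced_row r) \<and> (\<forall>p<length D. cnt (D ! p) = Cf p) \<and>
     (\<forall>p\<ge>length D. Cf p = (\<lambda>_. 0))"

lemma boxed_vanish:
  assumes "\<And>p. m \<le> p \<Longrightarrow> C p = (\<lambda>_. 0)" "boxed C b m = (\<lambda>_. 0)" "m \<le> p"
  shows "boxed C b p = (\<lambda>_. 0)"
  using assms(3)
proof (induction p rule: dec_induct)
  case (step p)
  have "rowb (\<lambda>_. 0) (\<lambda>_. 0) = (\<lambda>_. 0)"
  proof
    show "rowb (\<lambda>_. 0) (\<lambda>_. 0) i = 0" for i by (cases i) auto
  qed
  then show ?case using step.IH assms(1)[OF step.hyps(1)] by simp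
qed (rule assms)

text \<open>The finite action appends the boxed row arriving at the end; as this row is empty, it
  agrees with the empty row of the infinite array.\<close>

lemma represents_act:
  assumes "represents D Cf" "reduced_row x" "boxed Cf (cnt x) (length D) = (\<lambda>_. 0)"
  shows "represents (act D x) (iact Cf (cnt x))"
proof -
  have D: "\<forall>r\<in>set D. reduced_row r" "\<forall>p<length D. cnt (D ! p) = Cf p"
    "\<And>p. length D \<le> p \<Longrightarrow> Cf p = (\<lambda>_. 0)"
    using assms(1) unfolding represents_def by blast+
  have z: "iact Cf (cnt x) p = (\<lambda>_. 0)" if "length D \<le> p" for p
  proof -
    have "iact Cf (cnt x) p = rowc (Cf p) (\<lambda>_. 0)"
      unfolding iact_def by (rule arg_cong[OF boxed_vanish[of "length D" Cf, OF D(3) assms(3) that]])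
    then show ?thesis using rowc_le[of "Cf p" "\<lambda>_. 0"] by auto
  qed
  have "cnt (act D x ! p) = iact Cf (cnt x) p" if "p < Suc (length D)" for p
  proof (cases "p < length D")
    case True
    then show ?thesis using act_counts(1)[OF D(1) assms(2) D(2)] by blast
  next
    case False
    then have "p = length D" using that by simp
    then show ?thesis using act_counts(2)[OF D(1) assms(2) D(2)] assms(3) z[of p] by simp
  qed
  then show ?thesis using z good_act[OF D(1) assms(2)] unfolding represents_def by simp
qed

text \<open>If the circled and the boxed row agree, each ball takes a cell of its own value. The
  circled row is reproduced, and the boxed row is lowered by one throughout, which is the next row
  of the staircase.\<close>

lemma iact_stair: "iact (stair y) (stair y 0) = stair y" "boxed (stair y) (stair y 0) p = stair y p"
proof -
  have c0: "carry c c i = 0" for c i by (induction i) auto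
  have c: "rowc (stair y p) (stair y p) i = stair y p i" for p i by (cases i) (auto simp: c0)
  have b: "rowb (stair y p) (stair y p) = stair y (Suc p)" for p
  proof
    show "rowb (stair y p) (stair y p) i = stair y (Suc p) i" for i by (cases i) (auto simp: c0)
  qed
  have 1: "boxed (stair y) (stair y 0) p = stair y p" for p
    by (induction p) (simp_all add: b)
  then show "boxed (stair y) (stair y 0) p = stair y p" .
  show "iact (stair y) (stair y 0) = stair y" using c by (simp add: iact_def 1 fun_eq_iff)
qed

lemma foldl_act_stair:
  assumes "\<forall>x\<in>set xs. reduced_row x \<and> cnt x = stair y 0"
  shows "length (foldl act [] xs) = length xs \<and> (\<forall>r\<in>set (foldl act [] xs). reduced_row r) \<and>
    (\<forall>p<length xs. cnt (foldl act [] xs ! p) = stair y p)"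
  using assms
proof (induction xs rule: rev_induct)
  case Nil
  then show ?case by simp
next
  case (snoc x xs)
  let ?D = "foldl act [] xs"
  have D: "length ?D = length xs" "\<forall>r\<in>set ?D. reduced_row r" "\<forall>p<length ?D. cnt (?D ! p) = stair y p"
    and x: "reduced_row x" "cnt x = stair y 0"
    using snoc by auto
  have "cnt (act ?D x ! p) = stair y p" if "p < Suc (length xs)" for p
    using act_counts(1)[OF D(2) x(1) D(3), of p] act_counts(2)[OF D(2) x(1) D(3)] that unfolding x(2) iact_stair D(1)
    by (auto simp: less_Suc_eq)
  then show ?case using good_act[OF D(2) x(1)] D(1) by simp
qed

section \<open>Trailing empty rows\<close>

lemma strip_append_empty: "strip_empty_rows (D @ replicate m []) = strip_empty_rows D"
proof -
  have "dropWhile (\<lambda>r. r = []) (replicate m [] @ E) = dropWhile (\<lambda>r. r = []) E" for E :: "nat list list"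
    by (induction m) auto
  then show ?thesis by (simp add: strip_empty_rows_def)
qed

lemma strip_decompose: "\<exists>m. D = strip_empty_rows D @ replicate m []"
proof (induction D rule: rev_induct)
  case Nil
  then show ?case by (simp add: strip_empty_rows_def)
next
  case (snoc r D)
  show ?case
  proof (cases "r = []")
    case True
    obtain m where "D = strip_empty_rows D @ replicate m []" using snoc by blast
    then have "D @ [r] = strip_empty_rows D @ replicate (Suc m) []"
      using True by (simp add: replicate_append_same[symmetric] flip: append_assoc)
    moreover have "strip_empty_rows (D @ [r]) = strip_empty_rows D"
      using strip_append_empty[of D 1] True by simp
    ultimately show ?thesis by (intro exI[of _ "Suc m"]) simp
  next
    case False
    then have "strip_empty_rows (D @ [r]) = D @ [r]" by (simp add: strip_empty_rows_def)
    then show ?thesis by (intro exI[of _ 0]) simp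
  qed
qed

lemma represents_iff:
  "represents D Cf \<longleftrightarrow> (\<forall>r\<in>set D. reduced_row r) \<and>
     Cf = (\<lambda>p. if p < length D then cnt (D ! p) else (\<lambda>_. 0))"
  unfolding represents_def by (auto simp: fun_eq_iff)

lemma represents_append_empty:
  "represents (D @ replicate m []) Cf \<longleftrightarrow> represents D Cf"
proof -
  have "(if p < length (D @ replicate m []) then cnt ((D @ replicate m []) ! p) else (\<lambda>_. 0)) =
      (if p < length D then cnt (D ! p) else (\<lambda>_. 0))" for p
    by (auto simp: nth_append fun_eq_iff)
  then show ?thesis unfolding represents_iff by (auto simp: reduced_row_def)
qed

lemma represents_unique:
  assumes "represents D Cf" "represents D' Cf" "length D \<le> length D'"
  shows "D' = D @ replicate (length D' - length D) []"
proof (rule nth_equalityI)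
  show "length D' = length (D @ replicate (length D' - length D) [])" using assms(3) by simp
  fix p assume p: "p < length D'"
  show "D' ! p = (D @ replicate (length D' - length D) []) ! p"
  proof (cases "p < length D")
    case True
    then have "cnt (D ! p) = cnt (D' ! p)" using p assms unfolding represents_def by simp
    then have "mset (D ! p) = mset (D' ! p)" by (simp add: multiset_eq_iff)
    moreover have "sorted (D ! p)" "sorted (D' ! p)"
      using True p assms unfolding represents_def reduced_row_def by simp_all
    ultimately have "D ! p = D' ! p" by (metis properties_for_sort)
    then show ?thesis using True by (simp add: nth_append)
  next
    case False
    then have "cnt (D' ! p) = (\<lambda>_. 0)" using p assms unfolding represents_def by simp
    then have "mset (D' ! p) = {#}" by (simp add: multiset_eq_iff del: count_mset_0_iff)
    then show ?thesis using False p by (simp add: nth_append)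
  qed
qed

lemma strip_unique:
  assumes "represents D Cf" "represents D' Cf"
  shows "strip_empty_rows D = strip_empty_rows D'"
proof (cases "length D \<le> length D'")
  case True
  show ?thesis by (subst represents_unique[OF assms True]) (rule strip_append_empty[symmetric])
next
  case False
  then have le: "length D' \<le> length D" by simp
  show ?thesis by (subst represents_unique[OF assms(2,1) le]) (rule strip_append_empty)
qed

lemma represents_strip: "represents (strip_empty_rows D) Cf \<longleftrightarrow> represents D Cf"
proof -
  obtain m where "D = strip_empty_rows D @ replicate m []" using strip_decompose by blast
  then show ?thesis using represents_append_empty[of "strip_empty_rows D" m Cf] by simp
qed

lemma represents_fun:
  assumes "represents D Cf" "represents D Cf'"
  shows "Cf = Cf'"
  using assms unfolding represents_iff by simp

section \<open>Tableaux as chains of row lengths\<close>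

definition level_rows :: "box set \<Rightarrow> filling \<Rightarrow> (nat \<Rightarrow> nat \<Rightarrow> nat) \<Rightarrow> bool" where
  "level_rows I F l \<longleftrightarrow>
     (\<forall>j r c. ((r, c) \<in> I \<or> (\<exists>v. F (r, c) = Some v \<and> v \<le> j)) \<longleftrightarrow> c < l j r) \<and>
     I \<inter> dom F = {} \<and> (\<forall>b v. F b = Some v \<longrightarrow> 0 < v)"

lemma level_rowsD:
  assumes "level_rows I F l"
  shows "((r, c) \<in> I \<or> (\<exists>v. F (r, c) = Some v \<and> v \<le> j)) \<longleftrightarrow> c < l j r"
    and "b \<in> I \<Longrightarrow> F b = None" and "F b = Some v \<Longrightarrow> 0 < v"
proof -
  show "((r, c) \<in> I \<or> (\<exists>v. F (r, c) = Some v \<and> v \<le> j)) \<longleftrightarrow> c < l j r"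
    and "F b = Some v \<Longrightarrow> 0 < v"
    using assms unfolding level_rows_def by blast+
  have "I \<inter> dom F = {}" using assms unfolding level_rows_def by blast
  then show "b \<in> I \<Longrightarrow> F b = None" by blast
qed

lemma level_rows_inner:
  assumes "level_rows I F l"
  shows "I = {(r, c). c < l 0 r}"
proof -
  have "(r, c) \<in> I \<longleftrightarrow> c < l 0 r" for r c
    using level_rowsD(1)[OF assms, of r c 0] level_rowsD(3)[OF assms, of "(r, c)"] by auto
  then show ?thesis by auto
qed

lemma level_rows_outer:
  assumes "level_rows I F l" "strips L M l"
  shows "I \<union> dom F = {(r, c). c < l M r}"
proof -
  note l = level_rowsD(1)[OF assms(1)]
  have "(r, c) \<in> I \<union> dom F \<longleftrightarrow> c < l M r" for r c
  proof
    assume "(r, c) \<in> I \<union> dom F"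
    then consider "(r, c) \<in> I" | v where "F (r, c) = Some v" by blast
    then show "c < l M r"
    proof cases
      case (2 v)
      then have "c < l (max v M) r" using l[of r c "max v M"] by auto
      then show ?thesis using stripsD(3)[OF assms(2), of "max v M"] by simp
    qed (use l[of r c M] in blast)
  next
    assume "c < l M r"
    then show "(r, c) \<in> I \<union> dom F" using l[of r c M] by auto
  qed
  then show ?thesis by auto
qed

lemma finite_outer:
  assumes "level_rows I F l" "strips L M l"
  shows "finite (I \<union> dom F)"
proof -
  have "I \<union> dom F \<subseteq> (SIGMA r:{..<L}. {..<l M r})"
  proof
    fix b assume "b \<in> I \<union> dom F"
    moreover obtain r c where b: "b = (r, c)" by fastforce
    ultimately have "c < l M r" unfolding level_rows_outer[OF assms] by simp
    moreover from this have "r < L" using stripsD(4)[OF assms(2), of r M] by (metis not_le not_less0)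
    ultimately show "b \<in> (SIGMA r:{..<L}. {..<l M r})" using b by simp
  qed
  then show ?thesis by (rule finite_subset) simp
qed

lemma Fcount_eq:
  assumes "level_rows I F l"
  shows "Fcount I F i j = int (\<Sum>r<i. l j r)"
proof -
  have "{(r, c). (r, c) \<in> I \<union> dom F \<and> r < i \<and> (case F (r, c) of None \<Rightarrow> 0 | Some v \<Rightarrow> v) \<le> j}
      = (SIGMA r:{..<i}. {..<l j r})"
  proof -
    have "(r, c) \<in> I \<union> dom F \<and> (case F (r, c) of None \<Rightarrow> 0 | Some v \<Rightarrow> v) \<le> j \<longleftrightarrow> c < l j r" for r c
    proof -
      show ?thesis
        using level_rowsD(1)[OF assms, of r c j] level_rowsD(2)[OF assms, of "(r, c)"]
        by (auto split: option.splits)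
    qed
    then show ?thesis by auto
  qed
  then show ?thesis unfolding Fcount_def by simp
qed

lemma count_concat_replicate:
  "cnt (concat (map (\<lambda>i. replicate (f i) i) [1..<n])) i = (if 1 \<le> i \<and> i < n then f i else 0)"
  by (induction n) (auto simp: count_replicate_mset_if less_Suc_eq)

lemma sorted_concat_replicate: "sorted (concat (map (\<lambda>i. replicate (f i) i) [1..<n]))"
  by (induction n) (auto simp: sorted_append)

lemma wrow_props:
  assumes "level_rows I F l" "strips L M l"
  shows "reduced_row (wrow I F j)" "cnt (wrow I F j) = wfun l j"
proof -
  \<comment> \<open>The four sums telescope to one difference of row lengths, which is nonnegative
    by interlacing.\<close>
  have W: "nat (Wcoef I F (Suc k) j) = wfun l j (Suc k)" for k
    using stripsD(2)[OF assms(2), of j k] by (simp add: Wcoef_def Fcount_eq[OF assms(1)])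
  show "reduced_row (wrow I F j)"
    unfolding reduced_row_def wrow_def
    by (intro conjI sorted_concat_replicate) (auto simp del: upt_Suc)
  have fin: "finite (I \<union> dom F)" by (rule finite_outer[OF assms])
  \<comment> \<open>A nonempty row \<open>k\<close> forces \<open>k + 1\<close> boxes in the first
    column, so the range of rows in \<open>wrow\<close> misses no entry.\<close>
  have big: "l M k = 0" if "card (I \<union> dom F) \<le> k" for k
  proof (rule ccontr)
    assume "l M k \<noteq> 0"
    have "l M r > 0" if "r \<le> k" for r
      using that
    proof (induction r rule: inc_induct)
      case (step r)
      show ?case using strips_antimono[OF assms(2), of M r] step.IH by linarith
    qed (use \<open>l M k \<noteq> 0\<close> in simp)
    then have "(\<lambda>r. (r, 0)) ` {..k} \<subseteq> I \<union> dom F" unfolding level_rows_outer[OF assms] by auto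
    then have "card ((\<lambda>r. (r, 0::nat)) ` {..k}) \<le> card (I \<union> dom F)" by (rule card_mono[OF fin])
    then show False using that by (simp add: card_image inj_on_def)
  qed
  have mono: "l j r \<le> l M r" for j r
  proof (cases "M \<le> j")
    case False
    then have "j \<le> M" by simp
    with stripsD(1)[OF assms(2)] show ?thesis by (rule lift_Suc_mono_le[of "\<lambda>j. l j r"])
  qed (use stripsD(3)[OF assms(2), of j] in simp)
  show "cnt (wrow I F j) = wfun l j"
  proof
    fix i
    show "cnt (wrow I F j) i = wfun l j i"
    proof (cases i)
      case 0
      then show ?thesis unfolding wrow_def count_concat_replicate by simp
    next
      case (Suc k)
      have "wfun l j i = 0" if "\<not> i < card (I \<union> dom F) + 2"
        using big[of k] mono[of j k] that Suc by simp
      then show ?thesis unfolding wrow_def count_concat_replicate using W[of k] Suc by auto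
    qed
  qed
qed

lemma act_seq_represents:
  assumes "level_rows I F l" "strips L M l" "M + L \<le> N"
  shows "represents (act_seq (map (wrow I F) (rev [0..<Suc N]))) (arr l M 0)"
proof -
  let ?w = "wrow I F"
  note w = wrow_props[OF assms(1,2)]
  let ?D0 = "foldl act [] (map ?w (rev [M..<Suc N]))"
  have st: "wfun l j = stair (l M) 0" if "M \<le> j" for j
  proof
    show "wfun l j i = stair (l M) 0 i" for i
      using stripsD(3)[OF assms(2) that] stripsD(3)[OF assms(2), of "Suc j"] that by (cases i) auto
  qed
  have "\<forall>x\<in>set (map ?w (rev [M..<Suc N])). reduced_row x \<and> cnt x = stair (l M) 0"
    using w st by auto
  note D0 = foldl_act_stair[OF this]
  have zst: "stair (l M) p = (\<lambda>_. 0)" if "L \<le> p" for p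
  proof
    show "stair (l M) p i = 0" for i
      using stripsD(4)[OF assms(2), of "i - 1 + p" M] that by (cases i) auto
  qed
  \<comment> \<open>The arrays down to level \<open>M\<close> have built more than \<open>L\<close>
    rows, hence all nonempty rows of the staircase. Below level \<open>M\<close> every appended row
    is empty, by the chain property.\<close>
  have "represents (foldl act ?D0 (map ?w (rev [j..<M]))) (arr l M j) \<and>
    L \<le> length (foldl act ?D0 (map ?w (rev [j..<M])))" if "j \<le> M" for j
    using that
  proof (induction j rule: inc_induct)
    case base
    show ?case using D0 zst assms(3) by (simp add: represents_def arr_top)
  next
    case (step j)
    let ?D = "foldl act ?D0 (map ?w (rev [Suc j..<M]))"
    have ch: "chain L (l (Suc j)) (arr l M (Suc j))" using chain_arr[OF assms(2)] step.hyps by simp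
    have z: "arr l M (Suc j) p = (\<lambda>_. 0)" if "L \<le> p" for p
    proof
      show "arr l M (Suc j) p i = 0" for i
        using chain_zero[OF ch that] arr_0[of "Suc j" M l p] step.hyps by (cases i) auto
    qed
    have "boxed (arr l M (Suc j)) (wfun l j) L i = 0" for i
    proof (cases i)
      case 0
      then show ?thesis by (cases L) auto
    next
      case (Suc k)
      then show ?thesis
        using chain_iact(2)[OF ch, of "wfun l j" "l j"] stripsD(1,2)[OF assms(2)] by simp
    qed
    then have "boxed (arr l M (Suc j)) (wfun l j) L = (\<lambda>_. 0)" by blast
    then have "boxed (arr l M (Suc j)) (wfun l j) (length ?D) = (\<lambda>_. 0)"
      using boxed_vanish[of L "arr l M (Suc j)", OF z] step.IH by blast
    then have "represents (act ?D (?w j)) (arr l M j)"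
      using represents_act[of ?D "arr l M (Suc j)" "?w j"] step w by (simp add: arr_step)
    moreover have "[j..<M] = j # [Suc j..<M]" using step.hyps by (simp add: upt_conv_Cons)
    ultimately show ?case using step.IH by simp
  qed
  moreover have "rev [0..<Suc N] = rev [M..<Suc N] @ rev [0..<M]"
    using upt_add_eq_append[of 0 M "Suc N - M"] assms(3) by (simp del: upt_Suc)
  ultimately show ?thesis unfolding act_seq_def by (simp del: upt_Suc)
qed

text \<open>For all \<open>N \<ge> M + L\<close> the finite arrays represent the same infinite
  array, so they coincide after stripping and the description has a unique value.\<close>

lemma assoc_represents:
  assumes "level_rows I F l" "strips L M l"
  shows "\<exists>D. represents D (arr l M 0) \<and> assoc_circled_array I F = strip_empty_rows D"
proof -
  define D where "D = act_seq (map (wrow I F) (rev [0..<Suc (M + L)]))"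
  have D: "represents D (arr l M 0)"
    unfolding D_def using act_seq_represents[OF assms] by blast
  have eq: "circ_array_upto I F N = strip_empty_rows D" if "M + L \<le> N" for N
    unfolding circ_array_upto_def by (rule strip_unique[OF act_seq_represents[OF assms that] D])
  have "assoc_circled_array I F = strip_empty_rows D"
    unfolding assoc_circled_array_def
  proof (rule the_equality)
    show "\<exists>N0. \<forall>N\<ge>N0. circ_array_upto I F N = strip_empty_rows D" using eq by blast
    show "C = strip_empty_rows D" if ex: "\<exists>N0. \<forall>N\<ge>N0. circ_array_upto I F N = C" for C
    proof -
      obtain N0 where "\<forall>N\<ge>N0. circ_array_upto I F N = C" using ex by blast
      then show ?thesis using eq[of "max N0 (M + L)"] by simp
    qed
  qed
  then show ?thesis using D by blast
qed

lemma assoc_eq_iff: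
  assumes "level_rows I1 F1 l1" "strips L M l1" "level_rows I2 F2 l2" "strips L M l2"
  shows "assoc_circled_array I1 F1 = assoc_circled_array I2 F2 \<longleftrightarrow> arr l1 M 0 = arr l2 M 0"
proof -
  obtain D1 D2 where D: "represents D1 (arr l1 M 0)" "assoc_circled_array I1 F1 = strip_empty_rows D1"
    "represents D2 (arr l2 M 0)" "assoc_circled_array I2 F2 = strip_empty_rows D2"
    using assoc_represents[OF assms(1,2)] assoc_represents[OF assms(3,4)] by blast
  then show ?thesis using strip_unique represents_strip represents_fun by metis
qed

section \<open>Jeu de taquin on row lengths\<close>

abbreviation in_level :: "box set \<Rightarrow> filling \<Rightarrow> nat \<Rightarrow> box \<Rightarrow> bool" where
  "in_level I F j b \<equiv> b \<in> I \<or> (\<exists>v. F b = Some v \<and> v \<le> j)"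

text \<open>\<open>(a, c)\<close> is the hole. The levels below \<open>v\<close> are final, those from \<open>v\<close> on are still the
  original ones once the hole is added.\<close>
definition sliding ::
  "box set \<Rightarrow> (nat \<Rightarrow> nat \<Rightarrow> nat) \<Rightarrow> filling \<Rightarrow> nat \<Rightarrow> nat \<Rightarrow> nat \<Rightarrow> bool" where
  "sliding I l G v a c \<longleftrightarrow>
     (\<forall>j\<ge>v. \<forall>r k. in_level I G j (r, k) \<longleftrightarrow> k < l j r \<and> (r, k) \<noteq> (a, c)) \<and>
     c < l v a \<and> l v (Suc a) \<le> c \<and>
     (\<forall>k>c. (a, k) \<notin> I \<and> (\<forall>y. G (a, k) = Some y \<longrightarrow> v \<le> y)) \<and>
     (\<forall>b\<in>I. G b = None) \<and> (\<forall>b y. G b = Some y \<longrightarrow> 0 < y)"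

text \<open>The levels from \<open>v\<close> on have lost the last box of row \<open>h j\<close>;
  writing \<open>Suc k\<close> avoids a truncated subtraction in naming this box.\<close>

definition slide_result ::
  "box set \<Rightarrow> (nat \<Rightarrow> nat \<Rightarrow> nat) \<Rightarrow> filling \<Rightarrow> nat \<Rightarrow> (nat \<Rightarrow> nat) \<Rightarrow> filling \<Rightarrow> bool" where
  "slide_result I l G v h R \<longleftrightarrow>
     (\<forall>j<v. \<forall>b. in_level I R j b \<longleftrightarrow> in_level I G j b) \<and>
     (\<forall>j\<ge>v. \<forall>r k. in_level I R j (r, k) \<longleftrightarrow> k < l j r \<and> (r, Suc k) \<noteq> (h j, l j (h j))) \<and>
     (\<forall>b\<in>I. R b = None) \<and> (\<forall>b y. R b = Some y \<longrightarrow> 0 < y)"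

lemma slidingD:
  assumes "sliding I l G v a c"
  shows "v \<le> j \<Longrightarrow> in_level I G j (r, k) \<longleftrightarrow> k < l j r \<and> (r, k) \<noteq> (a, c)"
    and "c < l v a" "l v (Suc a) \<le> c"
    and "c < k \<Longrightarrow> (a, k) \<notin> I" "c < k \<Longrightarrow> G (a, k) = Some y \<Longrightarrow> v \<le> y"
    and "b \<in> I \<Longrightarrow> G b = None" "G b = Some y \<Longrightarrow> 0 < y"
  using assms unfolding sliding_def by blast+

text \<open>The recursion of \<open>hole\<close> from level \<open>v\<close> on only, so that one
  sequence \<open>h\<close> serves all moves of a slide.\<close>

definition hole_seq :: "(nat \<Rightarrow> nat \<Rightarrow> nat) \<Rightarrow> nat \<Rightarrow> (nat \<Rightarrow> nat) \<Rightarrow> bool" where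
  "hole_seq l v h \<longleftrightarrow> (\<forall>j\<ge>v. h (Suc j) = (if l (Suc j) (Suc (h j)) = l j (h j) then Suc (h j) else h j))"

lemma hole_seq_const:
  assumes "hole_seq l v h" "h v = a" "\<And>j. v \<le> j \<Longrightarrow> j < w \<Longrightarrow> l j a = Suc c"
    and "\<And>j. v \<le> j \<Longrightarrow> Suc j \<le> w \<Longrightarrow> l (Suc j) (Suc a) \<le> c" "v \<le> j" "j \<le> w"
  shows "h j = a"
  using assms(5,6)
proof (induction j rule: dec_induct)
  case (step j)
  have "h (Suc j) = (if l (Suc j) (Suc (h j)) = l j (h j) then Suc (h j) else h j)"
    using assms(1) step.hyps unfolding hole_seq_def by blast
  then show ?case using step assms(3)[of j] assms(4)[of j] by simp
qed (rule assms)

lemma strips_mono: "strips L M l \<Longrightarrow> i \<le> j \<Longrightarrow> l i r \<le> l j r"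
  using lift_Suc_mono_le[of "\<lambda>j. l j r" i j] stripsD(1) by blast

lemma sliding_hole_empty:
  assumes "sliding I l G v a c"
  shows "(a, c) \<notin> I" "G (a, c) = None"
proof -
  have no: "\<not> in_level I G j (a, c)" if "v \<le> j" for j using slidingD(1)[OF assms that, of a c] by blast
  show "(a, c) \<notin> I" using no[of v] by blast
  show "G (a, c) = None"
  proof (cases "G (a, c)")
    case (Some y)
    then show ?thesis using no[of "max v y"] by simp
  qed
qed

text \<open>With both neighbours missing, the hole is the last box of row \<open>a\<close> at every
  remaining level and the row below ends before it, so the hole row never changes again.\<close>

lemma slide_stop:
  assumes st: "strips L M l" and S: "sliding I l G v a c" and h: "hole_seq l v h" "h v = a"
    and none: "G (Suc a, c) = None" "G (a, Suc c) = None"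
  shows "slide_result I l G v h G"
proof -
  have down: "l j (Suc a) \<le> c" if "v \<le> j" for j
  proof (rule ccontr)
    assume "\<not> l j (Suc a) \<le> c"
    then have "(Suc a, c) \<in> I" using slidingD(1)[OF S that, of "Suc a" c] none by auto
    then show False using slidingD(1)[OF S order_refl, of "Suc a" c] slidingD(3)[OF S] by auto
  qed
  have right: "l j a = Suc c" if "v \<le> j" for j
  proof -
    have "\<not> Suc c < l j a"
      using slidingD(1)[OF S that, of a "Suc c"] slidingD(4)[OF S, of "Suc c"] none by auto
    moreover have "c < l j a" using slidingD(2)[OF S] strips_mono[OF st that, of a] by linarith
    ultimately show ?thesis by linarith
  qed
  have ha: "h j = a" if "v \<le> j" for j
    by (rule hole_seq_const[OF h, of "j" c]) (use down right that in auto)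
  show ?thesis
    unfolding slide_result_def
    using slidingD(1,6,7)[OF S] ha right by auto
qed

text \<open>Levels below \<open>x\<close> do not see the moved entry; from \<open>v\<close> on they
  lose the box \<open>(a, c)\<close>, by \<open>between\<close> the last one in row
  \<open>h j\<close>. Levels from \<open>x\<close> on are left to the later moves.\<close>

lemma slide_step_result:
  assumes st: "strips L M l" and S: "sliding I l G v a c"
    and G': "G' = G((a, c) := Some x, (a', c') := None)"
    and x: "G (a', c') = Some x" "v \<le> x"
    and between: "\<And>j. v \<le> j \<Longrightarrow> j < x \<Longrightarrow> l j a = Suc c \<and> h j = a"
    and R: "slide_result I l G' x h R"
  shows "slide_result I l G v h R"
proof -
  have R1: "in_level I R j b \<longleftrightarrow> in_level I G' j b" if "j < x" for j b
    using R that unfolding slide_result_def by blast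
  have R2: "in_level I R j (r, k) \<longleftrightarrow> k < l j r \<and> (r, Suc k) \<noteq> (h j, l j (h j))" if "x \<le> j" for j r k
    using R that unfolding slide_result_def by blast
  have eq: "in_level I G' j b \<longleftrightarrow> in_level I G j b" if "j < x" for j b
  proof -
    have "G (a, c) = None" by (rule sliding_hole_empty(2)[OF S])
    then show ?thesis using that x(1) by (auto simp: G')
  qed
  have "in_level I R j (r, k) \<longleftrightarrow> k < l j r \<and> (r, Suc k) \<noteq> (h j, l j (h j))" if "v \<le> j" for j r k
  proof (cases "x \<le> j")
    case False
    then have "in_level I R j (r, k) \<longleftrightarrow> in_level I G j (r, k)"
      using R1[of j "(r, k)"] eq[of j "(r, k)"] by simp
    then show ?thesis unfolding slidingD(1)[OF S that, of r k] using between[OF that] False by auto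
  qed (rule R2)
  moreover have "in_level I R j b \<longleftrightarrow> in_level I G j b" if "j < v" for j b
    using R1[of j b] eq[of j b] that x(2) by simp
  moreover have "(\<forall>b\<in>I. R b = None) \<and> (\<forall>b y. R b = Some y \<longrightarrow> 0 < y)"
    using R unfolding slide_result_def by (elim conjE) (intro conjI)
  ultimately show ?thesis unfolding slide_result_def by (intro conjI) simp_all
qed

text \<open>As the right neighbour is at least \<open>x\<close>, row \<open>a\<close> ends at the
  hole on all levels from \<open>v\<close> to \<open>x - 1\<close>. These levels are finished, and
  level \<open>x\<close> sends the hole one row down.\<close>

lemma slide_down:
  assumes st: "strips L M l" and S: "sliding I l G v a c"
    and x: "G (Suc a, c) = Some x" and y: "\<And>y. G (a, Suc c) = Some y \<Longrightarrow> x \<le> y"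
    and h: "hole_seq l v h" "h v = a"
  defines "G' \<equiv> G((a, c) := Some x, (Suc a, c) := None)"
  shows "v < x" "sliding I l G' x (Suc a) c" "h x = Suc a"
    and "v \<le> j \<Longrightarrow> j < x \<Longrightarrow> l j a = Suc c \<and> h j = a"
proof -
  have below: "(Suc a, k) \<notin> I \<and> (\<forall>z. G (Suc a, k) = Some z \<longrightarrow> v < z)" if "c \<le> k" for k
    using slidingD(1)[OF S order_refl, of "Suc a" k] slidingD(3)[OF S] that by auto
  show vx: "v < x" using below x by blast
  have right: "l j a = Suc c" if "v \<le> j" "j < x" for j
  proof -
    have "\<not> Suc c < l j a"
      using slidingD(1)[OF S that(1), of a "Suc c"] slidingD(4)[OF S, of "Suc c"] y that(2) by auto
    moreover have "c < l j a" using slidingD(2)[OF S] strips_mono[OF st that(1), of a] by linarith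
    ultimately show ?thesis by linarith
  qed
  have down: "l j (Suc a) \<le> c" if "v \<le> j" "j < x" for j
    using slidingD(1)[OF S that(1), of "Suc a" c] below[of c] x that(2) by auto
  have ha: "h j = a" if "v \<le> j" "j < x" for j
    by (rule hole_seq_const[OF h, of j c]) (use down right that in auto)
  then show "v \<le> j \<Longrightarrow> j < x \<Longrightarrow> l j a = Suc c \<and> h j = a" using right by blast
  obtain x' where x': "x = Suc x'" "v \<le> x'" using vx by (metis Suc_le_D Suc_le_eq Suc_le_mono)
  have cx: "c < l x (Suc a)" using slidingD(1)[OF S, of x "Suc a" c] x vx by auto
  \<comment> \<open>The moved entry puts column \<open>c\<close> into row \<open>Suc a\<close> of
    level \<open>x\<close>, and interlacing bounds that row by \<open>l x' a = Suc c\<close>. This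
    equality is the test for moving down.\<close>
  have lx: "l x (Suc a) = l x' a"
    using cx right[of x'] stripsD(2)[OF st, of x' a] x' by simp
  show "h x = Suc a"
    using h(1) ha[of x'] lx x' unfolding hole_seq_def by simp
  have c2: "l x (Suc (Suc a)) \<le> c"
    using stripsD(2)[OF st, of x' "Suc a"] down[of x'] x' by simp
  have row: "x \<le> z" if "c < k" "G (Suc a, k) = Some z" for k z
  proof (rule ccontr)
    assume "\<not> x \<le> z"
    moreover have "v < z" using below[of k] that by simp
    ultimately have z: "v \<le> z" "z < x" by auto
    have "k < l z (Suc a)" using slidingD(1)[OF S z(1), of "Suc a" k] that by auto
    then show False using down[OF z] that by simp
  qed
  have hole: "(a, c) \<notin> I" "G (a, c) = None" using sliding_hole_empty[OF S] by auto
  have lev: "in_level I G' j (r, k) \<longleftrightarrow> k < l j r \<and> (r, k) \<noteq> (Suc a, c)" if "x \<le> j" for j r k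
  proof -
    have "c < l j a" using slidingD(2)[OF S] strips_mono[OF st, of v j a] vx that by simp
    then show ?thesis
      using slidingD(1)[OF S, of j r k] vx that x below[of c] by (auto simp: G'_def)
  qed
  show "sliding I l G' x (Suc a) c"
    unfolding sliding_def
  proof (intro conjI allI ballI impI)
    show "(Suc a, k) \<notin> I" if "c < k" for k using below[of k] that by simp
    show "x \<le> z" if "c < k" "G' (Suc a, k) = Some z" for k z
      using row[of k z] that by (simp add: G'_def)
    show "G' b = None" if "b \<in> I" for b using that slidingD(6)[OF S that] hole by (auto simp: G'_def)
    show "0 < z" if "G' b = Some z" for b z
      using that slidingD(7)[OF S, of b z] vx by (auto simp: G'_def split: if_splits)
  qed (use lev cx c2 in blast)+
qed

text \<open>The entry below exceeds \<open>y\<close> strictly, so even level \<open>y\<close> does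
  not contain it and the hole row remains \<open>a\<close> up to and including level
  \<open>y\<close>.\<close>

lemma slide_right:
  assumes st: "strips L M l" and S: "sliding I l G v a c"
    and y: "G (a, Suc c) = Some y" and x: "\<And>x. G (Suc a, c) = Some x \<Longrightarrow> y < x"
    and h: "hole_seq l v h" "h v = a"
  defines "G' \<equiv> G((a, c) := Some y, (a, Suc c) := None)"
  shows "v \<le> y" "sliding I l G' y a (Suc c)" "h y = a"
    and "v \<le> j \<Longrightarrow> j < y \<Longrightarrow> l j a = Suc c \<and> h j = a"
proof -
  show vy: "v \<le> y" using slidingD(5)[OF S _ y] by simp
  have right: "l j a = Suc c" if "v \<le> j" "j < y" for j
  proof -
    have "\<not> Suc c < l j a"
      using slidingD(1)[OF S that(1), of a "Suc c"] slidingD(4)[OF S, of "Suc c"] y that(2) by auto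
    moreover have "c < l j a" using slidingD(2)[OF S] strips_mono[OF st that(1), of a] by linarith
    ultimately show ?thesis by linarith
  qed
  have nI: "(Suc a, c) \<notin> I" using slidingD(1)[OF S order_refl, of "Suc a" c] slidingD(3)[OF S] by auto
  have down: "l j (Suc a) \<le> c" if "v \<le> j" "j \<le> y" for j
    using slidingD(1)[OF S that(1), of "Suc a" c] nI x that(2) by force
  have ha: "h j = a" if "v \<le> j" "j \<le> y" for j
    by (rule hole_seq_const[OF h, of y c]) (use down right that in auto)
  then show "v \<le> j \<Longrightarrow> j < y \<Longrightarrow> l j a = Suc c \<and> h j = a" using right by simp
  show "h y = a" using ha vy by simp
  have cy: "Suc c < l y a" using slidingD(1)[OF S vy, of a "Suc c"] y by auto
  have row: "y \<le> z" if "Suc c < k" "G (a, k) = Some z" for k z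
  proof (rule ccontr)
    assume "\<not> y \<le> z"
    moreover have "v \<le> z" using slidingD(5)[OF S _ that(2)] that(1) by simp
    ultimately have z: "v \<le> z" "z < y" by auto
    have "k < l z a" using slidingD(1)[OF S z(1), of a k] that by auto
    then show False using right[OF z] that by simp
  qed
  have hole: "(a, c) \<notin> I" "G (a, c) = None" using sliding_hole_empty[OF S] by auto
  have rI: "(a, Suc c) \<notin> I" using slidingD(4)[OF S] by simp
  have lev: "in_level I G' j (r, k) \<longleftrightarrow> k < l j r \<and> (r, k) \<noteq> (a, Suc c)" if "y \<le> j" for j r k
  proof -
    have "c < l j a" using slidingD(2)[OF S] strips_mono[OF st, of v j a] vy that by simp
    then show ?thesis
      using slidingD(1)[OF S, of j r k] vy that y rI by (auto simp: G'_def)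
  qed
  have pos: "0 < y" using slidingD(7)[OF S y] .
  show "sliding I l G' y a (Suc c)"
    unfolding sliding_def
  proof (intro conjI allI ballI impI)
    show "l y (Suc a) \<le> Suc c" using down[of y] vy by simp
    show "(a, k) \<notin> I" if "Suc c < k" for k using slidingD(4)[OF S, of k] that by simp
    show "y \<le> z" if "Suc c < k" "G' (a, k) = Some z" for k z
      using row[of k z] that by (simp add: G'_def)
    show "G' b = None" if "b \<in> I" for b using that slidingD(6)[OF S that] hole by (auto simp: G'_def)
    show "0 < z" if "G' b = Some z" for b z
      using that slidingD(7)[OF S, of b z] pos by (auto simp: G'_def split: if_splits)
  qed (use lev cy in blast)+
qed

text \<open>The measure behind the fuel: the filled boxes weakly south-east of the hole decrease in
  number, because the moved entry leaves that region.\<close>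

lemma card_southeast_less:
  fixes G :: filling
  assumes "finite (dom G)" "G (a', c') = Some x" "a \<le> a'" "c \<le> c'" "a < a' \<or> c < c'"
  shows "card {b \<in> dom (G((a, c) := Some x, (a', c') := None)). a' \<le> fst b \<and> c' \<le> snd b} <
    card {b \<in> dom G. a \<le> fst b \<and> c \<le> snd b}"
proof (rule psubset_card_mono)
  show "finite {b \<in> dom G. a \<le> fst b \<and> c \<le> snd b}" using assms(1) by simp
  have "(a', c') \<in> {b \<in> dom G. a \<le> fst b \<and> c \<le> snd b}" using assms by auto
  moreover have "{b \<in> dom (G((a, c) := Some x, (a', c') := None)). a' \<le> fst b \<and> c' \<le> snd b}
      \<subseteq> {b \<in> dom G. a \<le> fst b \<and> c \<le> snd b} - {(a', c')}"
    using assms(3-5) by auto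
  ultimately show "{b \<in> dom (G((a, c) := Some x, (a', c') := None)). a' \<le> fst b \<and> c' \<le> snd b}
      \<subset> {b \<in> dom G. a \<le> fst b \<and> c \<le> snd b}" by blast
qed

lemma hole_seq_later: "hole_seq l v h \<Longrightarrow> v \<le> w \<Longrightarrow> hole_seq l w h"
  unfolding hole_seq_def by auto

lemma jdt_move_result:
  assumes "strips L M l" "sliding I l G v a c" "hole_seq l v h" "h v = a" "finite (dom G)"
    and "card {b \<in> dom G. a \<le> fst b \<and> c \<le> snd b} \<le> n"
  shows "slide_result I l G v h (jdt_move n G (a, c))"
  using assms(2-6)
proof (induction n arbitrary: G v a c)
  case 0
  \<comment> \<open>Without fuel no filled box lies south-east of the hole, so the slide has
    stopped.\<close>
  then have "{b \<in> dom G. a \<le> fst b \<and> c \<le> snd b} = {}" by simp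
  then have none: "b \<notin> dom G" if "a \<le> fst b" "c \<le> snd b" for b using that by blast
  have "G (Suc a, c) = None" "G (a, Suc c) = None"
    using none[of "(Suc a, c)"] none[of "(a, Suc c)"] by auto
  then show ?case using slide_stop[OF assms(1) 0(1-3)] by simp
next
  case (Suc n)
  note prems = Suc.prems
  consider (stop) "G (Suc a, c) = None" "G (a, Suc c) = None"
    | (down) x where "G (Suc a, c) = Some x" "\<And>y. G (a, Suc c) = Some y \<Longrightarrow> x \<le> y"
    | (right) y where "G (a, Suc c) = Some y" "\<And>x. G (Suc a, c) = Some x \<Longrightarrow> y < x"
    by (cases "G (Suc a, c)"; cases "G (a, Suc c)") (fastforce simp: not_le)+
  then show ?case
  proof cases
    case stop
    then show ?thesis using slide_stop[OF assms(1) prems(1-3)] by simp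
  next
    case down
    let ?G = "G((a, c) := Some x, (Suc a, c) := None)"
    note D = slide_down[OF assms(1) prems(1) down prems(2,3)]
    have "jdt_move (Suc n) G (a, c) = jdt_move n ?G (Suc a, c)"
      using down by (cases "G (a, Suc c)") auto
    moreover have "slide_result I l ?G x h (jdt_move n ?G (Suc a, c))"
    proof (rule Suc.IH[OF D(2) hole_seq_later[OF prems(2)] D(3)])
      show "v \<le> x" using D(1) by simp
      show "finite (dom ?G)" using prems(4) by simp
      show "card {b \<in> dom ?G. Suc a \<le> fst b \<and> c \<le> snd b} \<le> n"
        using card_southeast_less[OF prems(4) down(1), of a c] prems(5) by linarith
    qed
    ultimately show ?thesis
      using slide_step_result[OF assms(1) prems(1) refl down(1) _ D(4)] D(1) by simp
  next
    case right
    let ?G = "G((a, c) := Some y, (a, Suc c) := None)"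
    note D = slide_right[OF assms(1) prems(1) right prems(2,3)]
    have "jdt_move (Suc n) G (a, c) = jdt_move n ?G (a, Suc c)"
      using right by (cases "G (Suc a, c)") (auto simp: not_le[symmetric])
    moreover have "slide_result I l ?G y h (jdt_move n ?G (a, Suc c))"
    proof (rule Suc.IH[OF D(2) hole_seq_later[OF prems(2)] D(3)])
      show "v \<le> y" using D(1) by simp
      show "finite (dom ?G)" using prems(4) by simp
      show "card {b \<in> dom ?G. a \<le> fst b \<and> Suc c \<le> snd b} \<le> n"
        using card_southeast_less[OF prems(4) right(1), of a c] prems(5) by linarith
    qed
    ultimately show ?thesis
      using slide_step_result[OF assms(1) prems(1) refl right(1) D(1) D(4)] by simp
  qed
qed

section \<open>Rectification\<close>

definition downset :: "box set \<Rightarrow> bool" where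
  "downset I \<longleftrightarrow> (\<forall>r c r' c'. (r, c) \<in> I \<longrightarrow> r' \<le> r \<longrightarrow> c' \<le> c \<longrightarrow> (r', c') \<in> I)"

lemma downsetD: "downset I \<Longrightarrow> (r, c) \<in> I \<Longrightarrow> r' \<le> r \<Longrightarrow> c' \<le> c \<Longrightarrow> (r', c') \<in> I"
  unfolding downset_def by blast

lemma removable_corner:
  assumes "level_rows I F l" "(a, c) \<in> I" "downset (I - {(a, c)})"
  shows "l 0 a = Suc c" "l 0 (Suc a) \<le> c"
proof -
  have I: "(r, k) \<in> I \<longleftrightarrow> k < l 0 r" for r k using level_rows_inner[OF assms(1)] by auto
  have "(a, Suc c) \<notin> I" "(Suc a, c) \<notin> I"
    using downsetD[OF assms(3), of a "Suc c" a c] downsetD[OF assms(3), of "Suc a" c a c] by auto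
  then show "l 0 a = Suc c" "l 0 (Suc a) \<le> c" using assms(2) unfolding I by simp_all
qed

lemma level_rows_slide:
  assumes lr: "level_rows I F l" and st: "strips L M l"
    and b: "(a, c) \<in> I" "downset (I - {(a, c)})"
  shows "level_rows (I - {(a, c)}) (jdt_slide F (a, c)) (slid l a)"
proof -
  let ?I = "I - {(a, c)}"
  note corner = removable_corner[OF lr b]
  note lev = level_rowsD(1)[OF lr]
  have I: "(r, k) \<in> I \<longleftrightarrow> k < l 0 r" for r k using level_rows_inner[OF lr] by auto
  \<comment> \<open>At the start no level is finished, hence \<open>v = 0\<close>; the corner taken
    out of the inner shape is the hole.\<close>
  have S: "sliding ?I l F 0 a c"
    unfolding sliding_def
  proof (intro conjI allI ballI impI)
    show "in_level ?I F j (r, k) \<longleftrightarrow> k < l j r \<and> (r, k) \<noteq> (a, c)" for j r k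
      using lev[of r k j] level_rowsD(2)[OF lr b(1)] by auto
    show "(a, k) \<notin> ?I" if "c < k" for k using I[of a k] corner that by simp
    show "F p = None" if "p \<in> ?I" for p using level_rowsD(2)[OF lr] that by blast
    show "0 < y" if "F p = Some y" for p y using level_rowsD(3)[OF lr that] .
  qed (use corner in auto)
  have fin: "finite (dom F)" using finite_outer[OF lr st] by simp
  have R: "slide_result ?I l F 0 (hole l a) (jdt_slide F (a, c))"
    unfolding jdt_slide_def
  proof (rule jdt_move_result[OF st S _ _ fin])
    show "hole_seq l 0 (hole l a)" by (simp add: hole_seq_def)
    show "card {b \<in> dom F. a \<le> fst b \<and> c \<le> snd b} \<le> card (dom F)"
      by (rule card_mono[OF fin]) auto
  qed simp
  let ?R = "jdt_slide F (a, c)"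
  have "in_level ?I ?R j (r, k) \<longleftrightarrow> k < slid l a j r" for j r k
  proof -
    have "in_level ?I ?R j (r, k) \<longleftrightarrow> k < l j r \<and> (r, Suc k) \<noteq> (hole l a j, l j (hole l a j))"
      using R unfolding slide_result_def by blast
    then show ?thesis by (auto simp: slid_def)
  qed
  moreover have "\<forall>b\<in>?I. ?R b = None" "\<forall>b y. ?R b = Some y \<longrightarrow> 0 < y"
    using R unfolding slide_result_def by blast+
  moreover from this have "?I \<inter> dom ?R = {}" unfolding disjoint_iff domIff by simp
  ultimately show ?thesis unfolding level_rows_def by blast
qed

fun peels :: "box set \<Rightarrow> box list \<Rightarrow> bool" where
  "peels I [] \<longleftrightarrow> I = {}"
| "peels I (b # bs) \<longleftrightarrow> b \<in> I \<and> downset (I - {b}) \<and> peels (I - {b}) bs"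

lemma hd_jdt_shapes: "\<exists>ss. jdt_shapes I F bs = (I \<union> dom F, I) # ss"
  by (cases bs) auto

lemma outer_eq_iff:
  assumes "level_rows I1 F1 l1" "strips L M l1" "level_rows I2 F2 l2" "strips L M l2"
  shows "I1 \<union> dom F1 = I2 \<union> dom F2 \<longleftrightarrow> l1 M = l2 M"
proof
  assume "I1 \<union> dom F1 = I2 \<union> dom F2"
  then have e: "{(r, c). c < l1 M r} = {(r, c). c < l2 M r}"
    by (simp only: level_rows_outer[OF assms(1,2)] level_rows_outer[OF assms(3,4)])
  show "l1 M = l2 M"
  proof
    fix r
    have "c < l1 M r \<longleftrightarrow> c < l2 M r" for c using e by blast
    then show "l1 M r = l2 M r" by (metis linorder_neqE_nat nat_less_le)
  qed
qed (simp only: level_rows_outer[OF assms(1,2)] level_rows_outer[OF assms(3,4)])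

text \<open>An array tells which outer box a slide removes, so equality of the outer shapes is
  carried along the induction.\<close>

lemma jdt_shapes_eq_iff:
  assumes "level_rows I F1 l1" "strips L M l1" "level_rows I F2 l2" "strips L M l2"
    and "peels I bs" "l1 M = l2 M"
  shows "jdt_shapes I F1 bs = jdt_shapes I F2 bs \<longleftrightarrow> arr l1 M 0 = arr l2 M 0"
  using assms
proof (induction bs arbitrary: I F1 F2 l1 l2)
  case Nil
  have z: "arr l M 0 = (\<lambda>_ _. 0)" if "level_rows I F l" "strips L M l" for F l
  proof (intro ext)
    fix p i
    have "l 0 = (\<lambda>_. 0)"
    proof
      show "l 0 r = 0" for r using level_rowsD(1)[OF that(1), of r 0 0] level_rowsD(3)[OF that(1), of "(r, 0)"]
        Nil.prems(5) by (cases "l 0 r") auto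
    qed
    then have "chain L (\<lambda>_. 0) (arr l M 0)" using chain_arr[OF that(2), of 0] by simp
    then show "arr l M 0 p i = 0" using chain_empty arr_0[of 0 M l p] by (cases i) auto
  qed
  show ?case
    using z[OF Nil.prems(1,2)] z[OF Nil.prems(3,4)] outer_eq_iff[OF Nil.prems(1-4)] Nil.prems(6) by simp
next
  case (Cons b bs)
  note p = Cons.prems
  obtain a c where b: "b = (a, c)" by fastforce
  have bI: "(a, c) \<in> I" "downset (I - {(a, c)})" "peels (I - {(a, c)}) bs" using p(5) b by auto
  have c1: "l1 0 (Suc a) < l1 0 a" using removable_corner[OF p(1) bI(1,2)] by simp
  have c2: "l2 0 (Suc a) < l2 0 a" using removable_corner[OF p(3) bI(1,2)] by simp
  note s1 = level_rows_slide[OF p(1,2) bI(1,2)] strips_slid[OF p(2) c1]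
  note s2 = level_rows_slide[OF p(3,4) bI(1,2)] strips_slid[OF p(4) c2]
  note t1 = arr_slid[OF p(2) c1, of 0, simplified]
  note t2 = arr_slid[OF p(4) c2, of 0, simplified]
  let ?tails = "jdt_shapes (I - {b}) (jdt_slide F1 b) bs = jdt_shapes (I - {b}) (jdt_slide F2 b) bs"
  have "I \<union> dom F1 = I \<union> dom F2" using outer_eq_iff[OF p(1-4)] p(6) by simp
  then have "jdt_shapes I F1 (b # bs) = jdt_shapes I F2 (b # bs) \<longleftrightarrow> ?tails" by simp
  also have "\<dots> \<longleftrightarrow> arr l1 M 0 = arr l2 M 0"
  proof
    assume t: ?tails
    obtain ss1 ss2 where
      "jdt_shapes (I - {b}) (jdt_slide F1 b) bs = ((I - {b}) \<union> dom (jdt_slide F1 b), I - {b}) # ss1"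
      "jdt_shapes (I - {b}) (jdt_slide F2 b) bs = ((I - {b}) \<union> dom (jdt_slide F2 b), I - {b}) # ss2"
      using hd_jdt_shapes by metis
    with t have "(I - {b}) \<union> dom (jdt_slide F1 b) = (I - {b}) \<union> dom (jdt_slide F2 b)" by simp
    then have top: "slid l1 a M = slid l2 a M" using outer_eq_iff[OF s1 s2] b by simp
    then have "arr (slid l1 a) M 0 = arr (slid l2 a) M 0"
      using Cons.IH[OF s1 s2 bI(3)] t b by simp
    \<comment> \<open>Otherwise the first outer shape would lose a box that the second one
      keeps.\<close>
    moreover have "hole l1 a M = hole l2 a M"
    proof (rule ccontr)
      assume "hole l1 a M \<noteq> hole l2 a M"
      then have "l1 M (hole l1 a M) - 1 = l1 M (hole l1 a M)"
        using fun_cong[OF top, of "hole l1 a M"] p(6) by (simp add: slid_def)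
      then show False using hole_corner[OF p(2) c1, of M] by simp
    qed
    \<comment> \<open>Both trails reach 0 at the same row, so insertion recovers both arrays from
      the common new one.\<close>
    ultimately show "arr l1 M 0 = arr l2 M 0"
      using t1 t2
      by (intro pass_inj[of "arr l1 M 0" "Suc a" "arr l2 M 0" "Suc a" "Suc (hole l1 a M)"])
        (simp_all add: Suc_le_eq arr_0)
  next
    assume e: "arr l1 M 0 = arr l2 M 0"
    have "hole l1 a M < p \<longleftrightarrow> hole l2 a M < p" for p using t1 t2 e by metis
    then have h: "hole l1 a M = hole l2 a M" by (metis linorder_neqE_nat nat_less_le)
    have "slid l1 a M = slid l2 a M" using h p(6) by (simp add: slid_def fun_eq_iff)
    moreover have "arr (slid l1 a) M 0 = arr (slid l2 a) M 0" using t1 t2 e by metis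
    ultimately show ?tails using Cons.IH[OF s1 s2 bI(3)] b by simp
  qed
  finally show ?case .
qed

section \<open>Diagrams and standard tableaux\<close>

lemma downset_diagram:
  assumes "is_partition mu"
  shows "downset (diagram mu)"
proof -
  have "mu ! r \<le> mu ! r'" if "r' \<le> r" "r < length mu" for r r'
    using assms that unfolding is_partition_def by (cases "r' = r") (auto simp: sorted_wrt_iff_nth_less)
  then show ?thesis unfolding downset_def diagram_def by fastforce
qed

lemma finite_diagram: "finite (diagram mu)"
proof -
  have "diagram mu = (SIGMA r:{..<length mu}. {..<mu ! r})" by (auto simp: diagram_def)
  then show ?thesis by simp
qed

lemma downward_closed_eq_lessThan:
  fixes A :: "nat set"
  assumes "finite A" "\<And>x y. x \<in> A \<Longrightarrow> y \<le> x \<Longrightarrow> y \<in> A"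
  shows "A = {..<card A}"
proof (cases "A = {}")
  case False
  have "A = {..Max A}" using assms False by (auto intro: Max_ge assms(2)[OF Max_in])
  then have "A = {..<Suc (Max A)}" by (simp add: lessThan_Suc_atMost)
  then show ?thesis by (metis card_lessThan)
qed simp

text \<open>Weakly increasing rows make each level left-justified. Strictly increasing columns give
  the interlacing: a filled box above an entry at most \<open>j + 1\<close> has an entry at most
  \<open>j\<close>. All large \<open>M\<close> are allowed so that two tableaux can share
  one.\<close>

lemma skew_ssyt_level_rows:
  assumes lam: "is_partition lam" and mu: "is_partition mu" "diagram mu \<subseteq> diagram lam"
    and S: "skew_ssyt lam mu S"
  shows "\<exists>l M0. level_rows (diagram mu) S l \<and> (\<forall>M\<ge>M0. strips (length lam) M l)"
proof -
  let ?in = "in_level (diagram mu) S"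
  have dom: "dom S = diagram lam - diagram mu"
    and pos: "\<And>b v. S b = Some v \<Longrightarrow> 0 < v"
    and row: "\<And>r c c' v v'. c \<le> c' \<Longrightarrow> S (r, c) = Some v \<Longrightarrow> S (r, c') = Some v' \<Longrightarrow> v \<le> v'"
    and col: "\<And>r r' c v v'. r < r' \<Longrightarrow> S (r, c) = Some v \<Longrightarrow> S (r', c) = Some v' \<Longrightarrow> v < v'"
    using S unfolding skew_ssyt_def by blast+
  note dmu = downsetD[OF downset_diagram[OF mu(1)]]
  note dlam = downsetD[OF downset_diagram[OF lam]]
  have inlam: "b \<in> diagram lam" if "?in j b" for j b using that dom mu(2) by auto
  have left: "?in j (r, c')" if i: "?in j (r, c)" and le: "c' \<le> c" for j r c c'
  proof (cases "(r, c') \<in> diagram mu")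
    case False
    then have "(r, c) \<notin> diagram mu" using dmu[of r c r c'] le by blast
    then obtain v where v: "S (r, c) = Some v" "v \<le> j" using i by blast
    have "(r, c') \<in> dom S" using False dlam[OF inlam[OF i], of r c'] le dom by simp
    then obtain v' where v': "S (r, c') = Some v'" by blast
    show ?thesis using row[OF le v' v(1)] v v' by auto
  qed simp
  have up: "?in j (r, c)" if i: "?in (Suc j) (Suc r, c)" for j r c
  proof (cases "(r, c) \<in> diagram mu")
    case False
    then have "(Suc r, c) \<notin> diagram mu" using dmu[of "Suc r" c r c] by auto
    then obtain v where v: "S (Suc r, c) = Some v" "v \<le> Suc j" using i by blast
    have "(r, c) \<in> dom S" using False dlam[OF inlam[OF i], of r c] dom by simp
    then obtain v' where v': "S (r, c) = Some v'" by blast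
    show ?thesis using col[OF _ v' v(1)] v v' by auto
  qed simp
  define l where "l = (\<lambda>j r. card {c. ?in j (r, c)})"
  have l: "?in j (r, c) \<longleftrightarrow> c < l j r" for j r c
  proof -
    have "{c. ?in j (r, c)} \<subseteq> {..<lam ! r}" using inlam by (auto simp: diagram_def)
    then have "finite {c. ?in j (r, c)}" by (rule finite_subset) simp
    then have "{c. ?in j (r, c)} = {..<l j r}"
      unfolding l_def by (rule downward_closed_eq_lessThan) (use left in blast)
    then show ?thesis by blast
  qed
  have leI: "x \<le> y" if "\<And>k. k < x \<Longrightarrow> k < y" for x y :: nat using that by (meson not_le order_less_irrefl)
  have "finite (S ` dom S)" unfolding dom using finite_diagram by simp
  then have "finite (the ` S ` dom S)" by simp
  then obtain M0 where "\<forall>v\<in>the ` S ` dom S. v \<le> M0" using finite_nat_set_iff_bounded_le by auto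
  then have M0: "v \<le> M0" if "S b = Some v" for b v using that by force
  have "level_rows (diagram mu) S l"
    unfolding level_rows_def using l pos dom by blast
  moreover have "strips (length lam) M l" if M: "M0 \<le> M" for M
    unfolding strips_def
  proof (intro conjI allI impI)
    show "l j r \<le> l (Suc j) r" for j r
      by (rule leI) (use l in \<open>metis le_SucI\<close>)
    show "l (Suc j) (Suc r) \<le> l j r" for j r
      by (rule leI) (use l up in blast)
    show "l j = l M" if "M \<le> j" for j
    proof
      fix r
      have "k < l j r \<longleftrightarrow> k < l M r" for k
        unfolding l[symmetric] using M0[of "(r, k)"] M that by (meson le_trans)
      then show "l j r = l M r" by (metis linorder_neqE_nat nat_less_le)
    qed
    show "l j r = 0" if "length lam \<le> r" for j r
      using l[of r 0 j] inlam[of "(r, 0)" j] that by (auto simp: diagram_def)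
  qed
  ultimately show ?thesis by blast
qed

text \<open>The boxes with entry at most \<open>m\<close> form a downset for every \<open>m\<close>,
  so removing the largest entry first always removes a corner.\<close>

lemma peels_rect_order:
  assumes mu: "is_partition mu" and T: "standard_tableau mu T"
  shows "peels (diagram mu) (rect_order mu T)"
proof -
  let ?D = "diagram mu"
  have bij: "bij_betw T ?D {1..card ?D}"
    and row: "\<And>r c c'. (r, c) \<in> ?D \<Longrightarrow> (r, c') \<in> ?D \<Longrightarrow> c < c' \<Longrightarrow> T (r, c) < T (r, c')"
    and col: "\<And>r r' c. (r, c) \<in> ?D \<Longrightarrow> (r', c) \<in> ?D \<Longrightarrow> r < r' \<Longrightarrow> T (r, c) < T (r', c)"
    using T unfolding standard_tableau_def by blast+
  have down: "downset {b \<in> ?D. T b \<le> m}" for m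
    unfolding downset_def
  proof (intro allI impI)
    fix r c r' c' assume b: "(r, c) \<in> {b \<in> ?D. T b \<le> m}" and le: "r' \<le> r" "c' \<le> c"
    have D: "(r', c') \<in> ?D" "(r', c) \<in> ?D"
      using downsetD[OF downset_diagram[OF mu], of r c] b le by auto
    have "T (r', c') \<le> T (r', c)" using row[OF D] le by (cases "c' = c") auto
    also have "\<dots> \<le> T (r, c)" using col[OF D(2), of r] b le by (cases "r' = r") auto
    finally show "(r', c') \<in> {b \<in> ?D. T b \<le> m}" using b D by simp
  qed
  have "peels {b \<in> ?D. T b \<le> m} (map (the_inv_into ?D T) (rev [1..<Suc m]))" if "m \<le> card ?D" for m
    using that
  proof (induction m)
    case 0
    have "{b \<in> ?D. T b \<le> 0} = {}" using bij_betwE[OF bij] by force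
    then show ?case by simp
  next
    case (Suc m)
    let ?b = "the_inv_into ?D T (Suc m)"
    have b: "?b \<in> ?D" "T ?b = Suc m"
      using bij Suc.prems f_the_inv_into_f_bij_betw[OF bij, of "Suc m"]
        the_inv_into_into[of T ?D "Suc m" ?D] unfolding bij_betw_def by auto
    have "{b \<in> ?D. T b \<le> Suc m} - {?b} = {b \<in> ?D. T b \<le> m}"
    proof -
      have "T b = Suc m \<longleftrightarrow> b = ?b" if "b \<in> ?D" for b
        using that b bij unfolding bij_betw_def by (metis inj_on_def)
      moreover have "\<not> T ?b \<le> m" using b by simp
      ultimately show ?thesis by (auto simp: le_Suc_eq)
    qed
    then show ?case using Suc b down[of m] by simp
  qed
  from this[of "card ?D"] have "peels {b \<in> ?D. T b \<le> card ?D} (rect_order mu T)"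
    unfolding rect_order_def by simp
  moreover have "{b \<in> ?D. T b \<le> card ?D} = ?D" using bij_betwE[OF bij] by auto
  ultimately show ?thesis by simp
qed

text \<open>Numbering the boxes in row reading order works. Existence leads from all standard
  tableaux to some.\<close>

lemma standard_tableau_exists: "\<exists>T. standard_tableau mu T"
proof -
  let ?D = "diagram mu"
  define below where "below = (\<lambda>b. {b' \<in> ?D. fst b' < fst b \<or> fst b' = fst b \<and> snd b' \<le> snd b})"
  define T where "T = (\<lambda>b. card (below b))"
  have fin: "finite (below b)" for b using finite_diagram by (simp add: below_def)
  have less: "T b < T b'" if "b' \<in> ?D" "fst b < fst b' \<or> fst b = fst b' \<and> snd b < snd b'" for b b'
  proof -
    have "below b \<subset> below b'" using that by (auto simp: below_def)
    then show ?thesis unfolding T_def by (rule psubset_card_mono[OF fin])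
  qed
  have inj: "inj_on T ?D"
  proof (rule inj_onI)
    fix b b' assume "b \<in> ?D" "b' \<in> ?D" "T b = T b'"
    then show "b = b'" using less[of b' b] less[of b b'] by (metis less_irrefl linorder_neqE_nat prod_eqI)
  qed
  have "T ` ?D \<subseteq> {1..card ?D}"
  proof
    fix n assume "n \<in> T ` ?D"
    then obtain b where b: "b \<in> ?D" "n = T b" by blast
    have "b \<in> below b" using b by (simp add: below_def)
    then have "0 < T b" unfolding T_def using fin by (metis card_gt_0_iff empty_iff)
    moreover have "T b \<le> card ?D" unfolding T_def
      by (rule card_mono[OF finite_diagram]) (auto simp: below_def)
    ultimately show "n \<in> {1..card ?D}" using b by simp
  qed
  then have "T ` ?D = {1..card ?D}"
    by (intro card_subset_eq) (simp_all add: card_image[OF inj])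
  then show ?thesis
    unfolding standard_tableau_def bij_betw_def using inj less by (intro exI[of _ T]) auto
qed

theorem theorem3p12:
  fixes lam mu :: "nat list" and S1 S2 :: filling
  assumes "is_partition lam" and "is_partition mu" and "diagram mu \<subseteq> diagram lam"
    and "skew_ssyt lam mu S1" and "skew_ssyt lam mu S2"
  shows "(shape_equivalent mu S1 S2 \<longleftrightarrow>
            (\<exists>T. standard_tableau mu T \<and> same_shape_changes mu T S1 S2))
       \<and> (shape_equivalent mu S1 S2 \<longleftrightarrow>
            assoc_circled_array (diagram mu) S1 = assoc_circled_array (diagram mu) S2)"
proof -
  obtain l1 M1 where 1: "level_rows (diagram mu) S1 l1" "\<forall>M\<ge>M1. strips (length lam) M l1"
    using skew_ssyt_level_rows[OF assms(1-4)] by blast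
  obtain l2 M2 where 2: "level_rows (diagram mu) S2 l2" "\<forall>M\<ge>M2. strips (length lam) M l2"
    using skew_ssyt_level_rows[OF assms(1-3,5)] by blast
  \<comment> \<open>The arrays of both tableaux have to start from the same level to be
    compared.\<close>
  define M where "M = max M1 M2"
  have st: "strips (length lam) M l1" "strips (length lam) M l2" using 1(2) 2(2) by (simp_all add: M_def)
  have "dom S1 = dom S2" using assms(4,5) unfolding skew_ssyt_def by simp
  then have top: "l1 M = l2 M" using outer_eq_iff[OF 1(1) st(1) 2(1) st(2)] by simp
  \<comment> \<open>The right-hand side does not mention \<open>T\<close>, so one standard tableau
    decides for all.\<close>
  have "same_shape_changes mu T S1 S2 \<longleftrightarrow>
      assoc_circled_array (diagram mu) S1 = assoc_circled_array (diagram mu) S2"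
    if "standard_tableau mu T" for T
    unfolding same_shape_changes_def shape_changes_def
      jdt_shapes_eq_iff[OF 1(1) st(1) 2(1) st(2) peels_rect_order[OF assms(2) that] top]
      assoc_eq_iff[OF 1(1) st(1) 2(1) st(2)] ..
  then show ?thesis unfolding shape_equivalent_def using standard_tableau_exists[of mu] by blast
qed

end
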